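(* Let $T_0(x)=2x \pmod 1$ be the doubling map of $X=\mathbb{R}/\mathbb{Z}$, with transfer operator $\mathcal{L}_0$, and let $\rho^{(1)}\in C^1(X,\mathbb{R})$ have Fourier series $\rho^{(1)}(x)=\sum_{n\in\mathbb{Z}}a_n e^{2\pi i n x}$. Consider the equation $$(I-\mathcal{L}_0)\rho^{(1)}=\mathcal{L}_0\left(-\frac{\epsilon'}{2}\right) \qquad ( * )$$ for real valued $\epsilon\in H^1(X)$ with $\int_X\epsilon\,dx=0$. 1. The solutions of $( * )$ are exactly the functions $$\epsilon(x)=-\sum_{n\in 2\mathbb{Z}\setminus\{0\}}\frac{a_{n/2}-a_n}{\pi i n}e^{2\pi i n x}+\sum_{n\in\mathbb{Z}\setminus 2\mathbb{Z}}\frac{c_n}{\pi i n}e^{2\pi i n x},$$ where $(c_n)_{n\ \mathrm{odd}}$ is an arbitrary sequence in $\ell^2$ with $c_{-n}=\overline{c_n}$. 2. Among these solutions, the $L^2$ norm is minimised exactly by the one with all $c_n=0$, namely $$\epsilon_0(x)=-\sum_{n\in\mathbb{Z}\setminus\{0\}}\frac{a_n-a_{2n}}{2\pi i n}e^{2\pi i\,2n x}.$$ 3. If in addition $\rho^{(1)}\in C^3(X,\mathbb{R})$, then for all $a,b,c\ge0$ and $d>0$, $\epsilon_0$ is also the unique minimiser of $\|f\|_2+a\|f'\|_2+b\|f''\|_2+c\|f'''\|_2+d\|f''''\|_2$ among the solutions of $( * )$ belonging to $H^4(X)$.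
   Context: The transfer operator of the doubling map is $\mathcal{L}_0 w(x)=\sum_{2y=x \,(\mathrm{mod}\ 1)} w(y)/2$, acting on $L^1(X)$; the invariant density is the constant $1$. Equation $( * )$ is the condition that a first order perturbation $\epsilon$ of the map $T_0$ produces the first order change $\rho^{(1)}$ of its invariant density. $H^k(X)$ denotes the Sobolev space of functions on $X$ with weak derivatives up to order $k$ in $L^2(X)$, and $\|\cdot\|_2$ is the $L^2(X)$ norm with respect to Lebesgue measure. *)

theory Defs
  imports "HOL-Analysis.Analysis"
begin

text \<open>
  Functions on \<open>X = \<real>/\<int>\<close> are represented by 1-periodic functions on \<open>\<real>\<close>, points of \<open>X\<close> by their
  representatives in \<open>[0,1)\<close>, and Lebesgue measure on \<open>X\<close> by Lebesgue measure on \<open>[0,1)\<close>.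
  Elements of \<open>L\<^sup>1(X)\<close>, \<open>L\<^sup>2(X)\<close> and \<open>H\<^sup>k(X)\<close> are functions, with equality understood almost everywhere.
\<close>

definition circle_fun :: "(real \<Rightarrow> 'b) \<Rightarrow> bool" where
  "circle_fun f \<longleftrightarrow> (\<forall>x. f (x + 1) = f x)"

definition circle_measure :: "real measure" where
  "circle_measure = lebesgue_on {0..<1}"

definition L1_circle :: "(real \<Rightarrow> real) set" where
  "L1_circle = {f. circle_fun f \<and> integrable circle_measure f}"

definition L2_circle :: "(real \<Rightarrow> real) set" where
  "L2_circle = {f. circle_fun f \<and> f \<in> borel_measurable circle_measure \<and>
                   integrable circle_measure (\<lambda>x. (f x)\<^sup>2)}"

definition norm2 :: "(real \<Rightarrow> real) \<Rightarrow> real" where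
  "norm2 f = sqrt (\<integral>x. (f x)\<^sup>2 \<partial>circle_measure)"

definition Ck_circle :: "nat \<Rightarrow> (real \<Rightarrow> real) set" where
  "Ck_circle k = {f. circle_fun f \<and> (\<forall>j<k. \<forall>x. (deriv ^^ j) f differentiable (at x)) \<and>
                     continuous_on UNIV ((deriv ^^ k) f)}"

definition is_weak_deriv :: "nat \<Rightarrow> (real \<Rightarrow> real) \<Rightarrow> (real \<Rightarrow> real) \<Rightarrow> bool" where
  "is_weak_deriv j f g \<longleftrightarrow> g \<in> L1_circle \<and>
     (\<forall>\<phi> \<in> (\<Inter>k. Ck_circle k).
        (\<integral>x. f x * (deriv ^^ j) \<phi> x \<partial>circle_measure) =
        (- 1) ^ j * (\<integral>x. g x * \<phi> x \<partial>circle_measure))"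

text \<open>Some representative of the \<open>j\<close>-th weak derivative, which is unique up to null sets.\<close>

definition weak_deriv :: "nat \<Rightarrow> (real \<Rightarrow> real) \<Rightarrow> real \<Rightarrow> real" where
  "weak_deriv j f = (SOME g. is_weak_deriv j f g)"

definition Hk_circle :: "nat \<Rightarrow> (real \<Rightarrow> real) set" where
  "Hk_circle k = {f \<in> L2_circle. \<forall>j\<le>k. \<exists>g \<in> L2_circle. is_weak_deriv j f g}"

definition doubling_map :: "real \<Rightarrow> real" where
  "doubling_map x = frac (2 * x)"

definition transfer_op :: "(real \<Rightarrow> real) \<Rightarrow> real \<Rightarrow> real" where
  "transfer_op w x = (\<Sum>y | y \<in> {0..<1} \<and> doubling_map y = frac x. w y / 2)"

lemma transfer_op_eq: "transfer_op w x = (w (frac x / 2) + w ((frac x + 1) / 2)) / 2"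
proof -
  have "{y. y \<in> {0..<1} \<and> doubling_map y = frac x} = {frac x / 2, (frac x + 1) / 2}" (is "?L = ?R")
  proof
    show "?L \<subseteq> ?R"
    proof
      fix y assume "y \<in> ?L"
      then have y: "0 \<le> y" "y < 1" "2 * y - of_int \<lfloor>2 * y\<rfloor> = frac x"
        by (auto simp: doubling_map_def frac_def)
      then have "\<lfloor>2 * y\<rfloor> = 0 \<or> \<lfloor>2 * y\<rfloor> = 1"
        by linarith
      with y(3) show "y \<in> ?R"
        by auto
    qed
    have "0 \<le> frac x" "frac x < 1"
      by (auto simp: frac_lt_1)
    moreover have "doubling_map ((frac x + 1) / 2) = frac x"
    proof -
      have "2 * ((frac x + 1) / 2) = frac x + 1"
        by (simp add: field_simps)
      then have "doubling_map ((frac x + 1) / 2) = frac (frac x + 1)"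
        unfolding doubling_map_def by (rule arg_cong)
      then show ?thesis
        by (simp only: frac_1_eq frac_frac)
    qed
    ultimately show "?R \<subseteq> ?L"
      by (auto simp: doubling_map_def[of "frac x / 2"])
  qed
  moreover have "frac x / 2 \<noteq> (frac x + 1) / 2"
    by simp
  ultimately show ?thesis
    by (simp add: transfer_op_def add_divide_distrib)
qed

definition fourier_char :: "int \<Rightarrow> real \<Rightarrow> complex" where
  "fourier_char n x = exp (2 * pi * \<i> * of_int n * of_real x)"

definition fourier_coeff :: "(real \<Rightarrow> real) \<Rightarrow> int \<Rightarrow> complex" where
  "fourier_coeff f n = (\<integral>x. complex_of_real (f x) * fourier_char (- n) x \<partial>circle_measure)"

definition solutions :: "(real \<Rightarrow> real) \<Rightarrow> (real \<Rightarrow> real) set" where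
  "solutions \<rho> = {\<epsilon> \<in> Hk_circle 1. (\<integral>x. \<epsilon> x \<partial>circle_measure) = 0 \<and>
     (AE x in circle_measure.
        \<rho> x - transfer_op \<rho> x = transfer_op (\<lambda>y. - weak_deriv 1 \<epsilon> y / 2) x)}"

text \<open>The free sequences \<open>(c\<^sub>n)\<close>; only the values at odd \<open>n\<close> matter.\<close>

definition free_coeffs :: "(int \<Rightarrow> complex) set" where
  "free_coeffs = {c. (\<lambda>n. (cmod (c n))\<^sup>2) summable_on {n. odd n} \<and> (\<forall>n. odd n \<longrightarrow> c (- n) = cnj (c n))}"

definition even_term :: "(int \<Rightarrow> complex) \<Rightarrow> real \<Rightarrow> int \<Rightarrow> complex" where
  "even_term a x n = (a (n div 2) - a n) / (pi * \<i> * of_int n) * fourier_char n x"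

definition odd_term :: "(int \<Rightarrow> complex) \<Rightarrow> real \<Rightarrow> int \<Rightarrow> complex" where
  "odd_term c x n = c n / (pi * \<i> * of_int n) * fourier_char n x"

definition solution_series :: "(int \<Rightarrow> complex) \<Rightarrow> (int \<Rightarrow> complex) \<Rightarrow> real \<Rightarrow> complex" where
  "solution_series a c x =
     - (\<Sum>\<^sub>\<infinity>n \<in> {n. even n} - {0}. even_term a x n) + (\<Sum>\<^sub>\<infinity>n \<in> {n. odd n}. odd_term c x n)"

definition optimal_term :: "(int \<Rightarrow> complex) \<Rightarrow> real \<Rightarrow> int \<Rightarrow> complex" where
  "optimal_term a x n = (a n - a (2 * n)) / (2 * pi * \<i> * of_int n) * fourier_char (2 * n) x"

definition optimal_series :: "(int \<Rightarrow> complex) \<Rightarrow> real \<Rightarrow> complex" where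
  "optimal_series a x = - (\<Sum>\<^sub>\<infinity>n \<in> UNIV - {0}. optimal_term a x n)"

definition unique_minimiser ::
    "((real \<Rightarrow> real) \<Rightarrow> real) \<Rightarrow> (real \<Rightarrow> real) set \<Rightarrow> (real \<Rightarrow> real) \<Rightarrow> bool" where
  "unique_minimiser J S e \<longleftrightarrow> e \<in> S \<and> (\<forall>f\<in>S. J e \<le> J f) \<and>
     (\<forall>f\<in>S. J f = J e \<longrightarrow> (AE x in circle_measure. f x = e x))"

end

theory Submission
  imports Defs
begin

text \<open>
  Write \<open>a\<^sub>n\<close> and \<open>e\<^sub>n\<close> for the Fourier coefficients of \<open>\<rho>\<close> and \<open>\<epsilon>\<close>. The transfer operator turns the
  coefficient sequence \<open>w\<^sub>n\<close> into \<open>w\<^bsub>2n\<^esub>\<close>, and an integrable \<open>g\<close> is the \<open>j\<close>-th weak derivative of \<open>f\<close> iff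
  its coefficients are \<open>(2 \<pi> i n)\<^sup>j\<close> times those of \<open>f\<close>. As integrable functions are determined by
  their coefficients, the equation says \<open>a\<^sub>n - a\<^bsub>2n\<^esub> = - 2 \<pi> i n e\<^bsub>2n\<^esub>\<close>: it prescribes the even
  coefficients of \<open>\<epsilon>\<close> and leaves the odd ones free, subject to \<open>\<epsilon> \<in> H\<^sup>1\<close>, which by Riesz-Fischer means
  \<open>(n e\<^sub>n) \<in> \<ell>\<^sup>2\<close>. By Parseval, discarding the odd coefficients decreases the norms of \<open>\<epsilon>\<close> and of all its
  weak derivatives.
\<close>

section \<open>Integration and characters on the circle\<close>

text \<open>It comes from testing \<open>f\<close> against continuous approximations of
  \<open>sgn f\<close>, with Stone-Weierstrass on the unit circle supplying the trigonometric
  approximation. Once it is available, Parseval requires no density of trigonometric polynomials in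
  L2: Riesz-Fischer builds a function with the same coefficients and the right norm, and uniqueness
  identifies it with the given one. The series of the statement are unordered sums at every point.
  They converge absolutely because 2 |e_n| <= |n e_n|^2 + 1/n^2 for n nonzero, so square summability
  of (n e_n) makes (e_n) summable. A solution thus agrees almost everywhere with a continuous
  function, and sums may be integrated termwise by dominated convergence. The equation expresses one
  derivative of the even part of the solution through \<rho>; this is why a \<rho> with three
  derivatives gives an optimal solution with four.\<close>

lemma space_circle_measure [simp]: "space circle_measure = {0..<1}"
  by (simp add: circle_measure_def space_restrict_space)

interpretation circle: finite_measure circle_measure
  by standard (simp add: circle_measure_def emeasure_restrict_space)

lemma measure_circle_space [simp]: "measure circle_measure {0..<1} = 1"
  by (simp add: circle_measure_def measure_restrict_space)

lemma measurable_circle_continuous: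
  fixes f :: "real \<Rightarrow> 'b::topological_space"
  assumes "continuous_on UNIV f"
  shows "f \<in> borel_measurable circle_measure"
  unfolding circle_measure_def
  using assms by (intro continuous_imp_measurable_on_sets_lebesgue) (auto intro: continuous_on_subset)

lemma bounded_circle_continuous:
  fixes f :: "real \<Rightarrow> 'b::real_normed_vector"
  assumes "continuous_on UNIV f"
  obtains B where "B > 0" "\<And>x. x \<in> {0..<1} \<Longrightarrow> norm (f x) \<le> B"
proof -
  have "compact (f ` {0..1})"
    using assms by (intro compact_continuous_image) (auto intro: continuous_on_subset)
  then obtain B where "B > 0" "\<And>y. y \<in> f ` {0..1} \<Longrightarrow> norm y \<le> B"
    using compact_imp_bounded bounded_pos by metis
  then show ?thesis
    by (intro that[of B]) auto
qed

lemma integrable_circle_continuous: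
  fixes f :: "real \<Rightarrow> 'b::{banach, second_countable_topology}"
  assumes "continuous_on UNIV f"
  shows "integrable circle_measure f"
proof -
  obtain B where "\<And>x. x \<in> {0..<1} \<Longrightarrow> norm (f x) \<le> B"
    using bounded_circle_continuous[OF assms] by blast
  then show ?thesis
    by (intro circle.integrable_const_bound[of _ B] measurable_circle_continuous assms) auto
qed

lemma integrable_circle_mult_continuous:
  fixes f g :: "real \<Rightarrow> 'b::{banach, second_countable_topology, real_normed_algebra}"
  assumes "integrable circle_measure f" "continuous_on UNIV g"
  shows "integrable circle_measure (\<lambda>x. f x * g x)"
proof -
  obtain B where B: "\<And>x. x \<in> {0..<1} \<Longrightarrow> norm (g x) \<le> B" "B > 0"
    using bounded_circle_continuous[OF assms(2)] by blast
  have [measurable]: "f \<in> borel_measurable circle_measure" "g \<in> borel_measurable circle_measure"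
    using assms by (auto intro: measurable_circle_continuous)
  show ?thesis
  proof (rule Bochner_Integration.integrable_bound)
    show "integrable circle_measure (\<lambda>x. B * norm (f x))"
      using assms(1) by auto
    show "AE x in circle_measure. norm (f x * g x) \<le> norm (B * norm (f x))"
    proof (rule AE_I2)
      fix x assume x: "x \<in> space circle_measure"
      have "norm (f x * g x) \<le> norm (f x) * norm (g x)"
        by (rule norm_mult_ineq)
      also have "\<dots> \<le> norm (f x) * B"
        using B(1) x by (intro mult_left_mono) auto
      finally show "norm (f x * g x) \<le> norm (B * norm (f x))"
        using B(2) by (simp add: abs_mult mult.commute)
    qed
  qed measurable
qed

lemma integral_circle_FTC:
  fixes F :: "real \<Rightarrow> 'b::euclidean_space"
  assumes "\<And>x. (F has_vector_derivative f x) (at x)" "continuous_on UNIV f"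
  shows "(\<integral>x. f x \<partial>circle_measure) = F 1 - F 0"
proof -
  have "(\<integral>x. f x \<partial>circle_measure) = integral {0..<1} f"
    using integrable_circle_continuous[OF assms(2)] unfolding circle_measure_def
    by (rule lebesgue_integral_eq_integral) auto
  also have "\<dots> = integral {0..1} f"
    by (rule integral_spike_set) (auto intro: negligible_subset[of "{1}"])
  also have "\<dots> = F 1 - F 0"
    using assms(1) by (intro integral_unique fundamental_theorem_of_calculus)
       (auto intro: has_vector_derivative_at_within)
  finally show ?thesis .
qed

section \<open>Characters of the circle and their orthonormality\<close>

lemma fourier_char_eq_cis: "fourier_char n x = cis (2 * pi * of_int n * x)"
  by (simp add: fourier_char_def cis_conv_exp mult_ac)

lemma fourier_char_0 [simp]: "fourier_char 0 x = 1"
  by (simp add: fourier_char_def)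

lemma fourier_char_add: "fourier_char (m + n) x = fourier_char m x * fourier_char n x"
  by (simp add: fourier_char_eq_cis cis_mult ring_distribs)

lemma fourier_char_minus: "fourier_char (- n) x = cnj (fourier_char n x)"
  by (simp add: fourier_char_eq_cis cis_cnj)

lemma norm_fourier_char [simp]: "cmod (fourier_char n x) = 1"
  by (simp add: fourier_char_eq_cis)

lemma fourier_char_periodic: "fourier_char n (x + 1) = fourier_char n x"
proof -
  have "fourier_char n (x + 1) = cis (2 * pi * of_int n * x) * cis (2 * pi * of_int n)"
    unfolding fourier_char_eq_cis cis_mult by (simp add: ring_distribs)
  also have "cis (2 * pi * of_int n) = 1"
    by (rule cis_multiple_2pi) simp
  finally show ?thesis
    by (simp add: fourier_char_eq_cis)
qed

lemma has_vector_derivative_fourier_char: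
  "(fourier_char n has_vector_derivative (2 * pi * \<i> * of_int n) * fourier_char n x) (at x within S)"
proof -
  have "((\<lambda>z. exp (2 * pi * \<i> * of_int n * z)) has_field_derivative
          (2 * pi * \<i> * of_int n) * fourier_char n x) (at (of_real x))"
    unfolding fourier_char_def by (auto intro!: derivative_eq_intros)
  from has_vector_derivative_real_field[OF this]
  show ?thesis
    by (simp add: fourier_char_def[abs_def])
qed

lemma continuous_on_fourier_char [continuous_intros]:
  "continuous_on S g \<Longrightarrow> continuous_on S (\<lambda>x. fourier_char n (g x))"
  unfolding fourier_char_def by (intro continuous_intros)

lemma borel_measurable_fourier_char [measurable]: "fourier_char n \<in> borel_measurable circle_measure"
  by (intro measurable_circle_continuous continuous_intros)

lemma integral_fourier_char:
  "(\<integral>x. fourier_char n x \<partial>circle_measure) = (if n = 0 then 1 else 0)"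
proof (cases "n = 0")
  case False
  define w where "w = 2 * pi * \<i> * of_int n"
  have w: "w \<noteq> 0"
    using False by (simp add: w_def)
  have "((\<lambda>x. fourier_char n x / w) has_vector_derivative fourier_char n x) (at x)" for x
  proof -
    have "((\<lambda>x. (1 / w) * fourier_char n x) has_vector_derivative
            (1 / w) * (w * fourier_char n x)) (at x)"
      unfolding w_def by (intro has_vector_derivative_mult_right has_vector_derivative_fourier_char)
    then show ?thesis
      using w by simp
  qed
  then have "(\<integral>x. fourier_char n x \<partial>circle_measure) = fourier_char n 1 / w - fourier_char n 0 / w"
    by (rule integral_circle_FTC) (intro continuous_intros)
  also have "\<dots> = 0"
    using fourier_char_periodic[of n 0] by simp
  finally show ?thesis
    using False by simp
qed simp

section \<open>Uniqueness of Fourier coefficients\<close>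

lemma integrable_mult_fourier_char:
  assumes "integrable circle_measure f"
  shows "integrable circle_measure (\<lambda>x. complex_of_real (f x) * fourier_char n x)"
  using assms by (intro integrable_circle_mult_continuous integrable_of_real continuous_intros)

text \<open>Multiplication by a linear form in z = \<open>fourier_char 1 x\<close> shifts the
  coefficients by one in both directions, so vanishing of all of them is preserved. Keeping
  \<open>f\<close> arbitrary in the induction settles products: the hypothesis for \<open>q\<close>
  is applied to \<open>f\<close> times \<open>p\<close>.\<close>

lemma real_polynomial_fourier_coeff_zero:
  assumes "real_polynomial_function p" "integrable circle_measure f" "\<And>n. fourier_coeff f n = 0"
  shows "integrable circle_measure (\<lambda>x. f x * p (fourier_char 1 x)) \<and>
         (\<forall>n. fourier_coeff (\<lambda>x. f x * p (fourier_char 1 x)) n = 0)"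
  using assms
proof (induction arbitrary: f)
  case (linear p)
  \<comment> \<open>The coefficient of z when Re z = (z + cnj z)/2 and Im z = (z - cnj z)/(2i) are
    put into p z = Re z * p 1 + Im z * p i.\<close>
  define \<alpha> where "\<alpha> = Complex (p 1 / 2) (- p \<i> / 2)"
  have cont: "continuous_on UNIV (\<lambda>x. p (fourier_char 1 x))"
    by (intro linear_continuous_on_compose[of _ _ p] continuous_intros)
       (use linear.hyps in \<open>auto simp: linear_linear bounded_linear.linear\<close>)
  have p: "complex_of_real (p z) = \<alpha> * z + cnj \<alpha> * cnj z" for z
  proof -
    have "p z = p (Re z *\<^sub>R 1 + Im z *\<^sub>R \<i>)"
      by (rule arg_cong[of _ _ p]) (simp add: complex_eq_iff)
    also have "\<dots> = Re z * p 1 + Im z * p \<i>"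
      using linear.hyps by (simp add: linear_add linear_scale bounded_linear.linear)
    finally show ?thesis
      by (simp add: \<alpha>_def complex_eq_iff)
  qed
  have "fourier_coeff (\<lambda>x. f x * p (fourier_char 1 x)) n = 0" for n
  proof -
    have "complex_of_real (f x * p (fourier_char 1 x)) * fourier_char (- n) x =
            \<alpha> * (complex_of_real (f x) * fourier_char (- (n - 1)) x)
              + cnj \<alpha> * (complex_of_real (f x) * fourier_char (- (n + 1)) x)" for x
    proof -
      have "fourier_char (- (n - 1)) x = fourier_char 1 x * fourier_char (- n) x"
           "fourier_char (- (n + 1)) x = cnj (fourier_char 1 x) * fourier_char (- n) x"
        using fourier_char_add[of 1 "- n" x] fourier_char_add[of "- 1" "- n" x] fourier_char_minus[of 1 x]
        by (simp_all add: algebra_simps)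
      then show ?thesis
        by (simp add: p algebra_simps)
    qed
    then have "fourier_coeff (\<lambda>x. f x * p (fourier_char 1 x)) n =
        (\<integral>x. \<alpha> * (complex_of_real (f x) * fourier_char (- (n - 1)) x)
              + cnj \<alpha> * (complex_of_real (f x) * fourier_char (- (n + 1)) x) \<partial>circle_measure)"
      unfolding fourier_coeff_def by (rule arg_cong[OF ext])
    also have "\<dots> = \<alpha> * fourier_coeff f (n - 1) + cnj \<alpha> * fourier_coeff f (n + 1)"
      unfolding fourier_coeff_def
      by (subst Bochner_Integration.integral_add)
         (intro integrable_mult_right integrable_mult_fourier_char linear.prems(1) | simp only: integral_mult_right_zero)+
    finally have "fourier_coeff (\<lambda>x. f x * p (fourier_char 1 x)) n =
        \<alpha> * fourier_coeff f (n - 1) + cnj \<alpha> * fourier_coeff f (n + 1)" .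
    then show ?thesis
      using linear.prems by simp
  qed
  then show ?case
    using integrable_circle_mult_continuous[OF linear.prems(1) cont] by auto
next
  case (const c)
  have "fourier_coeff (\<lambda>x. f x * c) n = c * fourier_coeff f n" for n
    unfolding fourier_coeff_def by (subst integral_mult_right_zero[symmetric]) (simp add: mult_ac)
  then show ?case
    using const by auto
next
  case (add p q)
  have "fourier_coeff (\<lambda>x. f x * (p (fourier_char 1 x) + q (fourier_char 1 x))) n =
        fourier_coeff (\<lambda>x. f x * p (fourier_char 1 x)) n + fourier_coeff (\<lambda>x. f x * q (fourier_char 1 x)) n" for n
    unfolding fourier_coeff_def
    using add by (subst Bochner_Integration.integral_add[symmetric])
      (auto simp: ring_distribs simp del: of_real_mult intro!: integrable_mult_fourier_char)
  then show ?case
    using add by (auto simp: algebra_simps)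
next
  case (mult p q)
  show ?case
    using mult.IH(2)[of "\<lambda>x. f x * p (fourier_char 1 x)"] mult.IH(1)[of f] mult.prems
    by (simp add: mult.assoc)
qed

text \<open>Polynomials in the real and imaginary parts of z are uniformly dense on the circle by
  Stone-Weierstrass, and each integrates to zero against \<open>f\<close>; an error of
  \<open>e\<close> in \<Phi> costs at most \<open>e\<close> times the L1 norm of
  \<open>f\<close>.\<close>

lemma integral_mult_continuous_eq_0:
  fixes f :: "real \<Rightarrow> real" and \<Phi> :: "complex \<Rightarrow> real"
  assumes f: "integrable circle_measure f" "\<And>n. fourier_coeff f n = 0"
    and \<Phi>: "continuous_on (sphere 0 1) \<Phi>"
  shows "(\<integral>x. f x * \<Phi> (fourier_char 1 x) \<partial>circle_measure) = 0"
proof -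
  define I where "I = (\<integral>x. \<bar>f x\<bar> \<partial>circle_measure)"
  have cont: "continuous_on UNIV (\<lambda>x. \<Phi> (fourier_char 1 x))"
    by (rule continuous_on_compose2[OF \<Phi>]) (auto intro!: continuous_intros)
  have bd: "\<bar>\<integral>x. f x * \<Phi> (fourier_char 1 x) \<partial>circle_measure\<bar> \<le> e * I" if "e > 0" for e
  proof -
    obtain p where p: "real_polynomial_function p" "\<And>z. z \<in> sphere 0 1 \<Longrightarrow> \<bar>\<Phi> z - p z\<bar> < e"
      using Stone_Weierstrass_real_polynomial_function[OF compact_sphere \<Phi> \<open>e > 0\<close>] by blast
    have fp: "integrable circle_measure (\<lambda>x. f x * p (fourier_char 1 x))"
         "fourier_coeff (\<lambda>x. f x * p (fourier_char 1 x)) 0 = 0"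
      using real_polynomial_fourier_coeff_zero[OF p(1) f] by auto
    from fp(2) have fp0: "(\<integral>x. f x * p (fourier_char 1 x) \<partial>circle_measure) = 0"
      unfolding fourier_coeff_def by (simp del: of_real_mult)
    have f\<Phi>: "integrable circle_measure (\<lambda>x. f x * \<Phi> (fourier_char 1 x))"
      using f(1) cont by (rule integrable_circle_mult_continuous)
    have "(\<integral>x. f x * \<Phi> (fourier_char 1 x) \<partial>circle_measure) =
          (\<integral>x. f x * \<Phi> (fourier_char 1 x) - f x * p (fourier_char 1 x) \<partial>circle_measure)"
      using fp fp0 f\<Phi> by simp
    also have "\<bar>\<dots>\<bar> \<le> (\<integral>x. e * \<bar>f x\<bar> \<partial>circle_measure)"
    proof (rule integral_abs_bound_integral)
      fix x assume "x \<in> space circle_measure"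
      have "\<bar>f x\<bar> * \<bar>\<Phi> (fourier_char 1 x) - p (fourier_char 1 x)\<bar> \<le> \<bar>f x\<bar> * e"
        by (intro mult_left_mono less_imp_le[OF p(2)]) auto
      then show "\<bar>f x * \<Phi> (fourier_char 1 x) - f x * p (fourier_char 1 x)\<bar> \<le> e * \<bar>f x\<bar>"
        by (simp only: abs_mult[symmetric] right_diff_distrib mult.commute[of e])
    qed (use f f\<Phi> fp in auto)
    finally show ?thesis
      by (simp add: I_def)
  qed
  have "I \<ge> 0"
    by (simp add: I_def)
  have "\<bar>\<integral>x. f x * \<Phi> (fourier_char 1 x) \<partial>circle_measure\<bar> \<le> e" if "e > 0" for e
  proof -
    \<comment> \<open>Dividing by \<open>I + 1\<close> rather than \<open>I\<close> also covers
      \<open>I = 0\<close>.\<close>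
    have "e / (I + 1) * I \<le> e"
      using \<open>I \<ge> 0\<close> that by (simp add: field_simps)
    with bd[of "e / (I + 1)"] \<open>I \<ge> 0\<close> that show ?thesis
      by simp
  qed
  then show ?thesis
    using dense_ge[of 0 "\<bar>\<integral>x. f x * \<Phi> (fourier_char 1 x) \<partial>circle_measure\<bar>"] by auto
qed

text \<open>\<open>Arg2pi\<close> takes values in [0, 2 pi), which matches the representatives in
  [0,1), so it recovers x from z and turns functions of x into functions on the unit circle.\<close>

lemma Arg2pi_fourier_char_1:
  assumes "x \<in> {0..<1}"
  shows "Arg2pi (fourier_char 1 x) = 2 * pi * x"
  using assms by (intro Arg2pi_unique[of 1]) (auto simp: fourier_char_def mult_ac)

text \<open>A continuous function on \<open>[0,1)\<close> need not extend to the circle; the factor \<open>min 1 (k |z - 1|)\<close>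
  repairs this at the point \<open>z = 1\<close>.\<close>

lemma continuous_on_circle_cutoff:
  fixes g :: "real \<Rightarrow> real"
  assumes "continuous_on UNIV g" "\<And>x. \<bar>g x\<bar> \<le> 1"
  shows "continuous_on (sphere 0 1) (\<lambda>z. g (Arg2pi z / (2 * pi)) * min 1 (k * cmod (z - 1)))"
proof (intro continuous_at_imp_continuous_on ballI)
  fix z :: complex assume "z \<in> sphere 0 1"
  then have z: "cmod z = 1"
    by simp
  show "isCont (\<lambda>z. g (Arg2pi z / (2 * pi)) * min 1 (k * cmod (z - 1))) z"
  proof (cases "z = 1")
    case True
    have "((\<lambda>z. g (Arg2pi z / (2 * pi)) * min 1 (k * cmod (z - 1))) \<longlongrightarrow> 0) (at 1)"
    proof (rule Lim_null_comparison)
      show "\<forall>\<^sub>F z in at 1. norm (g (Arg2pi z / (2 * pi)) * min 1 (k * cmod (z - 1))) \<le> \<bar>min 1 (k * cmod (z - 1))\<bar>"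
        using assms(2) by (intro always_eventually) (auto simp: abs_mult intro!: mult_left_le_one_le)
      have "((\<lambda>z. \<bar>min 1 (k * cmod (z - 1))\<bar>) \<longlongrightarrow> \<bar>min 1 (k * cmod (1 - 1))\<bar>) (at 1)"
        by (intro tendsto_intros)
      then show "((\<lambda>z. \<bar>min 1 (k * cmod (z - 1))\<bar>) \<longlongrightarrow> 0) (at 1)"
        by simp
    qed
    then show ?thesis
      by (simp add: isCont_def True)
  next
    case False
    have "z \<notin> \<real>\<^sub>\<ge>\<^sub>0"
      using z False by (auto simp: complex_nonneg_Reals_iff complex_eq_iff cmod_eq_Re)
    then have "isCont Arg2pi z"
      by (rule continuous_at_Arg2pi)
    moreover have "isCont g y" for y
      using assms(1) by (simp add: continuous_on_eq_continuous_at)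
    ultimately have "isCont (\<lambda>z. g (Arg2pi z / (2 * pi))) z"
      by (intro isCont_o2[of _ "\<lambda>z. Arg2pi z / (2 * pi)" g] isCont_divide continuous_const) auto
    then show ?thesis
      by (intro continuous_intros)
  qed
qed

text \<open>The integral of \<open>f\<close> against \<open>sgn f\<close> is its L1 norm. As
  \<open>sgn f\<close> is an almost everywhere limit of continuous functions on the circle bounded
  by 1, against which \<open>f\<close> integrates to zero, dominated convergence makes this norm
  zero.\<close>

theorem fourier_coeff_eq_0_imp_AE_eq_0:
  assumes f: "integrable circle_measure f" "\<And>n. fourier_coeff f n = 0"
  shows "AE x in circle_measure. f x = 0"
proof -
  have [measurable]: "f \<in> borel_measurable circle_measure"
    using f(1) by auto
  have "(\<lambda>x. sgn (f x)) \<in> borel_measurable circle_measure"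
    by measurable
  \<comment> \<open>By definition \<open>measurable_on\<close> provides continuous functions on the
    line converging off a negligible set.\<close>
  then have "(\<lambda>x. sgn (f x)) measurable_on {0..<1}"
    by (subst measurable_on_iff_borel_measurable) (auto simp: circle_measure_def)
  then obtain N g where N: "negligible N" and g: "\<And>k. continuous_on UNIV (g k)"
      "\<And>x. x \<notin> N \<Longrightarrow> (\<lambda>k. g k x) \<longlonglongrightarrow> (if x \<in> {0..<1} then sgn (f x) else 0)"
    unfolding measurable_on_def by blast
  \<comment> \<open>Clipping to [-1,1] fixes the values of \<open>sgn\<close> and makes |f| a
    dominating function.\<close>
  define clip :: "real \<Rightarrow> real" where "clip y = max (-1) (min 1 y)" for y
  define \<Phi> :: "nat \<Rightarrow> complex \<Rightarrow> real"
    where "\<Phi> k z = clip (g k (Arg2pi z / (2 * pi))) * min 1 (real k * cmod (z - 1))" for k z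
  have cont_clip: "continuous_on UNIV (\<lambda>x. clip (g k x))" for k
    unfolding clip_def by (intro continuous_intros g)
  have \<Phi>_cont: "continuous_on (sphere 0 1) (\<Phi> k)" for k
    unfolding \<Phi>_def using cont_clip by (rule continuous_on_circle_cutoff) (auto simp: clip_def)
  have 0: "(\<integral>x. f x * \<Phi> k (fourier_char 1 x) \<partial>circle_measure) = 0" for k
    using f \<Phi>_cont by (rule integral_mult_continuous_eq_0)
  have \<Phi>_meas [measurable]: "(\<lambda>x. \<Phi> k (fourier_char 1 x)) \<in> borel_measurable circle_measure" for k
    by (intro measurable_circle_continuous continuous_on_compose2[OF \<Phi>_cont])
       (auto intro!: continuous_intros)
  have ae: "AE x in circle_measure. x \<notin> N \<and> x \<noteq> 0"
  proof -
    have "N \<union> {0} \<in> null_sets lebesgue"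
      using N by (simp add: negligible_iff_null_sets[symmetric])
    then have "AE x in lebesgue. x \<notin> N \<union> {0}"
      by (rule AE_not_in)
    then have "AE x in circle_measure. x \<notin> N \<union> {0}"
      unfolding circle_measure_def by (subst AE_restrict_space_iff) auto
    then show ?thesis
      by simp
  qed
  have "(\<lambda>k. \<integral>x. f x * \<Phi> k (fourier_char 1 x) \<partial>circle_measure) \<longlonglongrightarrow> (\<integral>x. \<bar>f x\<bar> \<partial>circle_measure)"
  proof (rule integral_dominated_convergence)
    show "AE x in circle_measure. (\<lambda>k. f x * \<Phi> k (fourier_char 1 x)) \<longlonglongrightarrow> \<bar>f x\<bar>"
      using ae AE_space
    proof eventually_elim
      case (elim x)
      then have x: "x \<in> {0..<1}" "x \<noteq> 0" "x \<notin> N"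
        by auto
      define r where "r = cmod (fourier_char 1 x - 1)"
      have "fourier_char 1 x \<noteq> 1"
      proof
        assume "fourier_char 1 x = 1"
        then have "Arg2pi 1 = 2 * pi * x"
          using Arg2pi_fourier_char_1[OF x(1)] by simp
        then show False
          using x by (simp add: Arg2pi_of_real[of 1, simplified])
      qed
      then have "r > 0"
        by (simp add: r_def)
      have "\<forall>\<^sub>F k in sequentially. real k \<ge> 1 / r"
        using filterlim_real_sequentially by (simp add: filterlim_at_top)
      then have "\<forall>\<^sub>F k in sequentially. min 1 (real k * r) = 1"
        by eventually_elim (use \<open>r > 0\<close> in \<open>auto simp: field_simps min_def\<close>)
      then have 1: "(\<lambda>k. min 1 (real k * r)) \<longlonglongrightarrow> 1"
        by (rule tendsto_eventually)
      have "(\<lambda>k. clip (g k x)) \<longlonglongrightarrow> clip (sgn (f x))"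
        unfolding clip_def using g(2)[OF x(3)] x(1) by (intro tendsto_intros) auto
      moreover have "clip (sgn (f x)) = sgn (f x)"
        by (auto simp: clip_def sgn_if)
      ultimately have "(\<lambda>k. f x * (clip (g k x) * min 1 (real k * r))) \<longlonglongrightarrow> f x * (sgn (f x) * 1)"
        using 1 by (intro tendsto_intros) auto
      moreover have "\<Phi> k (fourier_char 1 x) = clip (g k x) * min 1 (real k * r)" for k
        using x by (simp add: \<Phi>_def r_def Arg2pi_fourier_char_1)
      ultimately show ?case
        by (simp add: abs_sgn)
    qed
    show "AE x in circle_measure. norm (f x * \<Phi> k (fourier_char 1 x)) \<le> \<bar>f x\<bar>" for k
    proof (rule AE_I2)
      fix x
      have "\<bar>clip y\<bar> \<le> 1" for y
        by (auto simp: clip_def)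
      then have "\<bar>\<Phi> k (fourier_char 1 x)\<bar> \<le> 1"
        by (auto simp: \<Phi>_def abs_mult intro!: mult_le_one)
      then show "norm (f x * \<Phi> k (fourier_char 1 x)) \<le> \<bar>f x\<bar>"
        by (simp add: abs_mult mult_left_le)
    qed
  qed (use f in auto)
  then have "(\<integral>x. \<bar>f x\<bar> \<partial>circle_measure) = 0"
    by (simp add: 0 LIMSEQ_const_iff)
  then show ?thesis
    using f(1) by (subst (asm) integral_nonneg_eq_0_iff_AE) auto
qed

section \<open>Absolutely convergent Fourier series\<close>

lemma fourier_coeff_cong_AE:
  assumes "AE x in circle_measure. f x = g x"
    "f \<in> borel_measurable circle_measure" "g \<in> borel_measurable circle_measure"
  shows "fourier_coeff f n = fourier_coeff g n"
  unfolding fourier_coeff_def by (rule integral_cong_AE) (use assms in auto)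

lemma fourier_coeff_diff:
  assumes "integrable circle_measure f" "integrable circle_measure g"
  shows "fourier_coeff (\<lambda>x. f x - g x) n = fourier_coeff f n - fourier_coeff g n"
  unfolding fourier_coeff_def
  by (subst Bochner_Integration.integral_diff[symmetric])
     (auto simp: left_diff_distrib intro!: integrable_mult_fourier_char assms)

lemma fourier_coeff_minus: "fourier_coeff f (- n) = cnj (fourier_coeff f n)"
  unfolding fourier_coeff_def
  by (subst Bochner_Integration.integral_cnj[symmetric]) (simp flip: fourier_char_minus)

lemma fourier_coeff_0: "fourier_coeff f 0 = of_real (\<integral>x. f x \<partial>circle_measure)"
  by (simp add: fourier_coeff_def)

lemma fourier_coeff_inject_AE:
  assumes "integrable circle_measure f" "integrable circle_measure g"
    "\<And>n. fourier_coeff f n = fourier_coeff g n"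
  shows "AE x in circle_measure. f x = g x"
  using fourier_coeff_eq_0_imp_AE_eq_0[of "\<lambda>x. f x - g x"] assms
  by (auto simp: fourier_coeff_diff)

text \<open>Unordered sums over the integers are limits along a filter of finite sets, whereas
  dominated convergence and the subsequence argument for Riesz-Fischer are about sequences;
  symmetric partial sums connect the two and keep real series real.\<close>

lemma filterlim_symmetric_intervals:
  "filterlim (\<lambda>N. {- int N..int N}) (finite_subsets_at_top UNIV) sequentially"
  unfolding filterlim_iff eventually_finite_subsets_at_top
proof safe
  fix P :: "int set \<Rightarrow> bool" and X
  assume X: "finite X" and P: "\<forall>Y. finite Y \<and> X \<subseteq> Y \<and> Y \<subseteq> UNIV \<longrightarrow> P Y"
  obtain B where B: "\<And>x. x \<in> X \<Longrightarrow> \<bar>x\<bar> \<le> B"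
    using bdd_above_finite[of "abs ` X"] X by (auto simp: bdd_above_def)
  have "P {- int N..int N}" if "N \<ge> nat B" for N
    using that by (intro P[rule_format]) (fastforce dest: B)
  then show "\<forall>\<^sub>F N in sequentially. P {- int N..int N}"
    unfolding eventually_sequentially by blast
qed

lemma has_sum_imp_symmetric_sums:
  "(f has_sum S) UNIV \<Longrightarrow> (\<lambda>N. \<Sum>n\<in>{- int N..int N}. f n) \<longlonglongrightarrow> S"
  unfolding has_sum_def by (rule filterlim_compose[OF _ filterlim_symmetric_intervals])

definition fourier_series :: "(int \<Rightarrow> complex) \<Rightarrow> real \<Rightarrow> complex" where
  "fourier_series b x = (\<Sum>\<^sub>\<infinity>n. b n * fourier_char n x)"

text \<open>The symmetry of the coefficients of a real function; conversely it makes a series with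
  such coefficients real valued.\<close>

definition hermitian_seq :: "(int \<Rightarrow> complex) \<Rightarrow> bool" where
  "hermitian_seq b \<longleftrightarrow> (\<forall>n. b (- n) = cnj (b n))"

lemma hermitian_fourier_coeff: "hermitian_seq (fourier_coeff f)"
  by (simp add: hermitian_seq_def fourier_coeff_minus)

lemma summable_fourier_series:
  assumes "(\<lambda>n. cmod (b n)) summable_on UNIV"
  shows "(\<lambda>n. b n * fourier_char n x) summable_on A"
proof -
  have "(\<lambda>n. norm (b n * fourier_char n x)) summable_on UNIV"
    using assms by (simp add: norm_mult)
  then show ?thesis
    by (rule summable_on_subset_banach[OF abs_summable_summable subset_UNIV])
qed

lemma continuous_on_fourier_series:
  assumes "(\<lambda>n. cmod (b n)) summable_on UNIV"
  shows "continuous_on UNIV (fourier_series b)"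
proof -
  have "uniform_limit UNIV (\<lambda>X x. \<Sum>n\<in>X. b n * fourier_char n x)
          (\<lambda>x. \<Sum>\<^sub>\<infinity>n. b n * fourier_char n x) (finite_subsets_at_top UNIV)"
    by (rule Weierstrass_m_test_general[OF _ assms]) (simp add: norm_mult)
  then have "continuous_on UNIV (\<lambda>x. \<Sum>\<^sub>\<infinity>n. b n * fourier_char n x)"
    by (rule uniform_limit_theorem[rotated])
       (auto intro!: always_eventually continuous_intros)
  then show ?thesis
    by (simp add: fourier_series_def[abs_def])
qed

lemma fourier_series_periodic: "fourier_series b (x + 1) = fourier_series b x"
  by (simp add: fourier_series_def fourier_char_periodic)

lemma fourier_series_real:
  assumes "hermitian_seq b"
  shows "fourier_series b x \<in> \<real>"
proof -
  have "cnj (fourier_series b x) = (\<Sum>\<^sub>\<infinity>n. b (- n) * fourier_char (- n) x)"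
    unfolding fourier_series_def using assms
    by (simp add: infsum_cnj hermitian_seq_def fourier_char_minus flip: complex_cnj_mult)
  also have "\<dots> = fourier_series b x"
    unfolding fourier_series_def
    using infsum_reindex_bij_betw[of uminus UNIV UNIV "\<lambda>n. b n * fourier_char n x"]
    by (simp add: bij_uminus)
  finally show ?thesis
    by (simp add: Reals_cnj_iff)
qed

text \<open>Termwise integration by dominated convergence: every partial sum is bounded by the sum
  \<open>B\<close> of the moduli. With \<open>h\<close> a character this yields the coefficients of
  the series, with \<open>h\<close> a function it yields the pairing with test functions.\<close>

lemma integral_fourier_series:
  assumes b: "(\<lambda>n. cmod (b n)) summable_on UNIV" and h: "integrable circle_measure h"
  shows "(\<integral>x. h x * fourier_series b x \<partial>circle_measure) =
         (\<Sum>\<^sub>\<infinity>n. b n * (\<integral>x. h x * fourier_char n x \<partial>circle_measure))"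
proof -
  let ?c = "\<lambda>n. \<integral>x. h x * fourier_char n x \<partial>circle_measure"
  define B where "B = (\<Sum>\<^sub>\<infinity>n. cmod (b n))"
  define I where "I = (\<integral>x. cmod (h x) \<partial>circle_measure)"
  have [measurable]: "h \<in> borel_measurable circle_measure"
      "fourier_series b \<in> borel_measurable circle_measure"
    using h b by (auto intro: measurable_circle_continuous continuous_on_fourier_series)
  have hn: "integrable circle_measure (\<lambda>x. h x * fourier_char n x)" for n
    using h by (intro integrable_circle_mult_continuous continuous_intros)
  have "cmod (?c n) \<le> I" for n
    using integral_norm_bound[of circle_measure "\<lambda>x. h x * fourier_char n x"]
    by (simp add: norm_mult I_def)
  then have "cmod (b n * ?c n) \<le> cmod (b n) * I" for n
    unfolding norm_mult by (intro mult_left_mono) auto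
  moreover have "(\<lambda>n. cmod (b n) * I) summable_on UNIV"
    using b by (rule summable_on_cmult_left)
  ultimately have "(\<lambda>n. norm (b n * ?c n)) summable_on UNIV"
    by (rule Infinite_Sum.abs_summable_on_comparison_test'[rotated])
  then have "((\<lambda>n. b n * ?c n) has_sum (\<Sum>\<^sub>\<infinity>n. b n * ?c n)) UNIV"
    by (rule has_sum_infsum[OF abs_summable_summable])
  then have 1: "(\<lambda>N. \<Sum>n\<in>{- int N..int N}. b n * ?c n) \<longlonglongrightarrow> (\<Sum>\<^sub>\<infinity>n. b n * ?c n)"
    by (rule has_sum_imp_symmetric_sums)
  have "(\<lambda>N. \<integral>x. h x * (\<Sum>n\<in>{- int N..int N}. b n * fourier_char n x) \<partial>circle_measure)
          \<longlonglongrightarrow> (\<integral>x. h x * fourier_series b x \<partial>circle_measure)"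
  proof (rule integral_dominated_convergence)
    show "integrable circle_measure (\<lambda>x. cmod (h x) * B)"
      using h by auto
    show "AE x in circle_measure. (\<lambda>N. h x * (\<Sum>n\<in>{- int N..int N}. b n * fourier_char n x))
            \<longlonglongrightarrow> h x * fourier_series b x"
      unfolding fourier_series_def
      by (intro AE_I2 tendsto_mult tendsto_const has_sum_imp_symmetric_sums has_sum_infsum
            summable_fourier_series b)
    show "AE x in circle_measure. cmod (h x * (\<Sum>n\<in>{- int N..int N}. b n * fourier_char n x))
            \<le> cmod (h x) * B" for N
    proof (rule AE_I2)
      fix x
      have "cmod (\<Sum>n\<in>{- int N..int N}. b n * fourier_char n x) \<le> (\<Sum>n\<in>{- int N..int N}. cmod (b n))"
        by (rule order_trans[OF norm_sum]) (simp add: norm_mult)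
      also have "\<dots> \<le> B"
        unfolding B_def using b by (intro finite_sum_le_infsum) auto
      finally show "cmod (h x * (\<Sum>n\<in>{- int N..int N}. b n * fourier_char n x)) \<le> cmod (h x) * B"
        unfolding norm_mult by (rule mult_left_mono) auto
    qed
  qed measurable
  moreover have "(\<integral>x. h x * (\<Sum>n\<in>{- int N..int N}. b n * fourier_char n x) \<partial>circle_measure) =
        (\<Sum>n\<in>{- int N..int N}. b n * ?c n)" for N
  proof -
    have "(\<integral>x. h x * (\<Sum>n\<in>{- int N..int N}. b n * fourier_char n x) \<partial>circle_measure) =
          (\<integral>x. (\<Sum>n\<in>{- int N..int N}. b n * (h x * fourier_char n x)) \<partial>circle_measure)"
      by (simp add: sum_distrib_left mult_ac)
    also have "\<dots> = (\<Sum>n\<in>{- int N..int N}. b n * ?c n)"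
      using hn by simp
    finally show ?thesis .
  qed
  ultimately show ?thesis
    using 1 LIMSEQ_unique by auto
qed

lemma fourier_coeff_fourier_series:
  assumes b: "(\<lambda>n. cmod (b n)) summable_on UNIV" "hermitian_seq b"
  shows "fourier_coeff (\<lambda>x. Re (fourier_series b x)) m = b m"
proof -
  have "fourier_coeff (\<lambda>x. Re (fourier_series b x)) m =
        (\<integral>x. fourier_char (- m) x * fourier_series b x \<partial>circle_measure)"
    unfolding fourier_coeff_def using fourier_series_real[OF b(2)] by (simp add: mult.commute)
  also have "\<dots> = (\<Sum>\<^sub>\<infinity>n. b n * (\<integral>x. fourier_char (- m) x * fourier_char n x \<partial>circle_measure))"
    by (intro integral_fourier_series b integrable_circle_continuous continuous_intros)
  also have "\<dots> = (\<Sum>\<^sub>\<infinity>n\<in>{m}. b n)"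
    by (rule infsum_cong_neutral) (auto simp: integral_fourier_char simp flip: fourier_char_add)
  finally show ?thesis
    by simp
qed

lemma integrable_fourier_series:
  assumes "(\<lambda>n. cmod (b n)) summable_on UNIV"
  shows "integrable circle_measure (\<lambda>x. Re (fourier_series b x))"
  using assms by (intro integrable_circle_continuous continuous_intros continuous_on_fourier_series)

text \<open>The sum of the series is a continuous function with the same coefficients as
  \<open>f\<close>, so uniqueness suffices and no theorem on pointwise convergence enters.\<close>

lemma AE_eq_fourier_series:
  assumes f: "integrable circle_measure f" and "(\<lambda>n. cmod (fourier_coeff f n)) summable_on UNIV"
  shows "AE x in circle_measure. complex_of_real (f x) = fourier_series (fourier_coeff f) x"
proof -
  have "AE x in circle_measure. f x = Re (fourier_series (fourier_coeff f) x)"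
    using assms by (intro fourier_coeff_inject_AE integrable_fourier_series)
      (auto simp: fourier_coeff_fourier_series hermitian_fourier_coeff)
  then show ?thesis
    by eventually_elim (auto simp: fourier_series_real hermitian_fourier_coeff)
qed

text \<open>All summability is demanded of the smoother factor, so \<open>f\<close> may be any
  integrable function; this is what the pairing with test functions in the definition of weak
  derivatives calls for.\<close>

lemma integral_mult_eq_infsum_fourier_coeff:
  assumes f: "integrable circle_measure f" and \<phi>: "continuous_on UNIV \<phi>"
    and summable: "(\<lambda>n. cmod (fourier_coeff \<phi> n)) summable_on UNIV"
  shows "complex_of_real (\<integral>x. f x * \<phi> x \<partial>circle_measure) =
         (\<Sum>\<^sub>\<infinity>n. fourier_coeff \<phi> n * fourier_coeff f (- n))"
proof -
  have [measurable]: "f \<in> borel_measurable circle_measure" "\<phi> \<in> borel_measurable circle_measure"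
     "fourier_series (fourier_coeff \<phi>) \<in> borel_measurable circle_measure"
    using f \<phi> summable by (auto intro: measurable_circle_continuous continuous_on_fourier_series)
  have "complex_of_real (\<integral>x. f x * \<phi> x \<partial>circle_measure) =
        (\<integral>x. complex_of_real (f x) * complex_of_real (\<phi> x) \<partial>circle_measure)"
    by (simp flip: integral_complex_of_real)
  also have "\<dots> = (\<integral>x. complex_of_real (f x) * fourier_series (fourier_coeff \<phi>) x \<partial>circle_measure)"
    using AE_eq_fourier_series[OF integrable_circle_continuous[OF \<phi>] summable]
    by (intro integral_cong_AE) (auto elim!: eventually_mono)
  also have "\<dots> = (\<Sum>\<^sub>\<infinity>n. fourier_coeff \<phi> n * fourier_coeff f (- n))"
    using f by (subst integral_fourier_series[OF summable]) (auto simp: fourier_coeff_def)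
  finally show ?thesis .
qed

section \<open>Square integrable functions\<close>

lemma L2_circleD:
  assumes "f \<in> L2_circle"
  shows "circle_fun f" "f \<in> borel_measurable circle_measure" "integrable circle_measure (\<lambda>x. (f x)\<^sup>2)"
  using assms by (simp_all add: L2_circle_def)

lemma L2_circle_imp_integrable:
  assumes "f \<in> L2_circle"
  shows "integrable circle_measure f"
  by (rule circle.square_integrable_imp_integrable) (intro L2_circleD assms)+

lemma L2_circle_imp_L1_circle:
  assumes "f \<in> L2_circle"
  shows "f \<in> L1_circle"
  unfolding L1_circle_def by (intro CollectI conjI L2_circleD L2_circle_imp_integrable assms)

lemma continuous_imp_L2_circle:
  assumes "circle_fun f" "continuous_on UNIV f"
  shows "f \<in> L2_circle"
  using assms unfolding L2_circle_def
  by (auto intro!: measurable_circle_continuous integrable_circle_continuous continuous_intros)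

lemma L2_circle_diff:
  assumes "f \<in> L2_circle" "g \<in> L2_circle"
  shows "(\<lambda>x. f x - g x) \<in> L2_circle"
proof -
  have [measurable]: "f \<in> borel_measurable circle_measure" "g \<in> borel_measurable circle_measure"
    using assms by (auto simp: L2_circle_def)
  have "integrable circle_measure (\<lambda>x. (f x - g x)\<^sup>2)"
  proof (rule Bochner_Integration.integrable_bound)
    show "integrable circle_measure (\<lambda>x. 2 * (f x)\<^sup>2 + 2 * (g x)\<^sup>2)"
      using assms by (auto simp: L2_circle_def)
    have "(f x - g x)\<^sup>2 \<le> 2 * (f x)\<^sup>2 + 2 * (g x)\<^sup>2" for x
      using zero_le_power2[of "f x + g x"] by (simp add: power2_eq_square algebra_simps)
    then show "AE x in circle_measure. norm ((f x - g x)\<^sup>2) \<le> norm (2 * (f x)\<^sup>2 + 2 * (g x)\<^sup>2)"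
      by (intro AE_I2) simp
  qed measurable
  then show ?thesis
    using assms by (auto simp: L2_circle_def circle_fun_def)
qed

lemma integral_norm_trig_poly_square:
  assumes "finite S"
  shows "(\<integral>x. (cmod (\<Sum>n\<in>S. p n * fourier_char n x))\<^sup>2 \<partial>circle_measure) = (\<Sum>n\<in>S. (cmod (p n))\<^sup>2)"
proof -
  have "complex_of_real ((cmod (\<Sum>n\<in>S. p n * fourier_char n x))\<^sup>2) =
        (\<Sum>n\<in>S. \<Sum>m\<in>S. p n * cnj (p m) * fourier_char (n - m) x)" for x
  proof -
    have "fourier_char (n - m) x = fourier_char n x * cnj (fourier_char m x)" for n m
      using fourier_char_add[of n "- m" x] by (simp add: fourier_char_minus)
    then show ?thesis
      by (simp only: complex_norm_square cnj_sum sum_product) (simp add: mult_ac)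
  qed
  then have "complex_of_real (\<integral>x. (cmod (\<Sum>n\<in>S. p n * fourier_char n x))\<^sup>2 \<partial>circle_measure) =
        (\<integral>x. (\<Sum>n\<in>S. \<Sum>m\<in>S. p n * cnj (p m) * fourier_char (n - m) x) \<partial>circle_measure)"
    unfolding integral_complex_of_real[symmetric] by presburger
  also have "\<dots> = (\<Sum>n\<in>S. \<Sum>m\<in>S. p n * cnj (p m) * (\<integral>x. fourier_char (n - m) x \<partial>circle_measure))"
    by (subst Bochner_Integration.integral_sum;
        (intro Bochner_Integration.integrable_sum integrable_circle_continuous continuous_intros)?)
       (intro sum.cong refl, subst Bochner_Integration.integral_sum,
         auto intro!: integrable_circle_continuous continuous_intros)
  also have "\<dots> = (\<Sum>n\<in>S. p n * cnj (p n))"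
    using assms by (simp add: integral_fourier_char if_distrib sum.delta' cong: if_cong)
  also have "\<dots> = complex_of_real (\<Sum>n\<in>S. (cmod (p n))\<^sup>2)"
    by (simp only: of_real_sum complex_norm_square)
  finally show ?thesis
    by (simp only: of_real_eq_iff)
qed

text \<open>Pythagoras for the orthogonal projection onto the characters in \<open>S\<close>. Its
  nonnegativity is Bessel's inequality, and the exact identity for \<open>S\<close> = {0} gives the
  norm bound in Riesz-Fischer.\<close>

lemma integral_dist_trig_poly_square:
  assumes f: "f \<in> L2_circle" and S: "finite S"
  shows "(\<integral>x. (cmod (complex_of_real (f x) - (\<Sum>n\<in>S. fourier_coeff f n * fourier_char n x)))\<^sup>2 \<partial>circle_measure)
           = (\<integral>x. (f x)\<^sup>2 \<partial>circle_measure) - (\<Sum>n\<in>S. (cmod (fourier_coeff f n))\<^sup>2)"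
proof -
  define P where "P x = (\<Sum>n\<in>S. fourier_coeff f n * fourier_char n x)" for x
  have P_cont: "continuous_on UNIV P"
    unfolding P_def by (intro continuous_intros)
  have fi: "integrable circle_measure f"
    by (rule L2_circle_imp_integrable[OF f])
  have fP: "integrable circle_measure (\<lambda>x. complex_of_real (f x) * cnj (P x))"
    using fi by (intro integrable_circle_mult_continuous integrable_of_real continuous_intros P_cont)
  have "(cmod (complex_of_real (f x) - P x))\<^sup>2 =
          (f x)\<^sup>2 - 2 * Re (complex_of_real (f x) * cnj (P x)) + (cmod (P x))\<^sup>2" for x
    by (simp only: cmod_power2) (simp add: power2_eq_square algebra_simps)
  then have "(\<integral>x. (cmod (complex_of_real (f x) - P x))\<^sup>2 \<partial>circle_measure) =
     (\<integral>x. (f x)\<^sup>2 - 2 * Re (complex_of_real (f x) * cnj (P x)) + (cmod (P x))\<^sup>2 \<partial>circle_measure)"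
    by presburger
  also have "\<dots> = (\<integral>x. (f x)\<^sup>2 \<partial>circle_measure) -
       2 * Re (\<integral>x. complex_of_real (f x) * cnj (P x) \<partial>circle_measure) +
       (\<integral>x. (cmod (P x))\<^sup>2 \<partial>circle_measure)"
  proof -
    have "integrable circle_measure (\<lambda>x. (f x)\<^sup>2)"
      using f by (simp add: L2_circle_def)
    moreover have "integrable circle_measure (\<lambda>x. (cmod (P x))\<^sup>2)"
      by (intro integrable_circle_continuous continuous_intros P_cont)
    moreover have "integrable circle_measure (\<lambda>x. 2 * Re (complex_of_real (f x) * cnj (P x)))"
      using fP by (intro integrable_mult_right integrable_Re)
    moreover have "(\<integral>x. 2 * Re (complex_of_real (f x) * cnj (P x)) \<partial>circle_measure) =
        2 * Re (\<integral>x. complex_of_real (f x) * cnj (P x) \<partial>circle_measure)"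
      using integral_Re[OF fP] by (simp only: integral_mult_right_zero)
    ultimately show ?thesis
      by simp
  qed
  also have "(\<integral>x. complex_of_real (f x) * cnj (P x) \<partial>circle_measure) =
      (\<Sum>n\<in>S. complex_of_real ((cmod (fourier_coeff f n))\<^sup>2))"
  proof -
    have "complex_of_real (f x) * cnj (P x) =
          (\<Sum>n\<in>S. cnj (fourier_coeff f n) * (complex_of_real (f x) * fourier_char (- n) x))" for x
      by (simp add: P_def sum_distrib_left fourier_char_minus mult_ac)
    then have "(\<integral>x. complex_of_real (f x) * cnj (P x) \<partial>circle_measure) =
       (\<Sum>n\<in>S. cnj (fourier_coeff f n) * fourier_coeff f n)"
      unfolding fourier_coeff_def using integrable_mult_fourier_char[OF fi] by simp
    then show ?thesis
      by (simp only: complex_norm_square mult.commute)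
  qed
  also have "(\<integral>x. (cmod (P x))\<^sup>2 \<partial>circle_measure) = (\<Sum>n\<in>S. (cmod (fourier_coeff f n))\<^sup>2)"
    unfolding P_def by (rule integral_norm_trig_poly_square[OF S])
  finally show ?thesis
    by (simp add: P_def)
qed

lemma Bessel_finite:
  assumes "f \<in> L2_circle" "finite S"
  shows "(\<Sum>n\<in>S. (cmod (fourier_coeff f n))\<^sup>2) \<le> (\<integral>x. (f x)\<^sup>2 \<partial>circle_measure)"
proof -
  have "0 \<le> (\<integral>x. (cmod (complex_of_real (f x) - (\<Sum>n\<in>S. fourier_coeff f n * fourier_char n x)))\<^sup>2 \<partial>circle_measure)"
    by simp
  then show ?thesis
    unfolding integral_dist_trig_poly_square[OF assms] by simp
qed

lemma Bessel:
  assumes "f \<in> L2_circle"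
  shows "(\<lambda>n. (cmod (fourier_coeff f n))\<^sup>2) summable_on UNIV"
    and "(\<Sum>\<^sub>\<infinity>n. (cmod (fourier_coeff f n))\<^sup>2) \<le> (\<integral>x. (f x)\<^sup>2 \<partial>circle_measure)"
proof -
  show "(\<lambda>n. (cmod (fourier_coeff f n))\<^sup>2) summable_on UNIV"
    by (rule nonneg_bdd_above_summable_on)
       (auto intro!: bdd_aboveI2 Bessel_finite[OF assms])
  then show "(\<Sum>\<^sub>\<infinity>n. (cmod (fourier_coeff f n))\<^sup>2) \<le> (\<integral>x. (f x)\<^sup>2 \<partial>circle_measure)"
    by (rule infsum_le_finite_sums) (auto intro: Bessel_finite[OF assms])
qed

text \<open>The partial sums are Cauchy in \<open>L\<^sup>2\<close>, hence in \<open>L\<^sup>1\<close>, so a subsequence converges almost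
  everywhere; Fatou's lemma bounds the \<open>L\<^sup>2\<close> distance of its limit to the partial sums.\<close>

lemma Riesz_Fischer:
  assumes d: "hermitian_seq d" "(\<lambda>n. (cmod (d n))\<^sup>2) summable_on UNIV"
  obtains g where "g \<in> L2_circle" "\<And>n. fourier_coeff g n = d n"
    "(\<integral>x. (g x)\<^sup>2 \<partial>circle_measure) \<le> (\<Sum>\<^sub>\<infinity>n. (cmod (d n))\<^sup>2)"
proof -
  define P where "P N x = (\<Sum>n\<in>{- int N..int N}. d n * fourier_char n x)" for N :: nat and x
  define s where "s N x = Re (P N x)" for N x
  define D where "D = (\<Sum>\<^sub>\<infinity>n. (cmod (d n))\<^sup>2)"
  define T where "T N = D - (\<Sum>n\<in>{- int N..int N}. (cmod (d n))\<^sup>2)" for N :: nat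
  have "(\<lambda>N. \<Sum>n\<in>{- int N..int N}. (cmod (d n))\<^sup>2) \<longlonglongrightarrow> D"
    unfolding D_def by (intro has_sum_imp_symmetric_sums has_sum_infsum d)
  then have T_lim: "T \<longlonglongrightarrow> 0"
    unfolding T_def[abs_def] by (auto intro!: tendsto_eq_intros)
  have P_real: "complex_of_real (s N x) = P N x" for N x
  proof -
    have "cnj (P N x) = (\<Sum>n\<in>{- int N..int N}. d (- n) * fourier_char (- n) x)"
      using d(1) by (simp add: P_def fourier_char_minus hermitian_seq_def)
    also have "\<dots> = P N x"
      unfolding P_def by (rule sum.reindex_bij_witness[of _ uminus uminus]) auto
    finally show ?thesis
      by (simp add: s_def Reals_cnj_iff)
  qed
  have s_cont: "continuous_on UNIV (s N)" for N
    unfolding s_def P_def by (intro continuous_intros)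
  have s_periodic: "s N (x + 1) = s N x" for N x
    by (simp add: s_def P_def fourier_char_periodic)
  have s_L2: "s N \<in> L2_circle" for N
    using s_cont s_periodic by (intro continuous_imp_L2_circle) (auto simp: circle_fun_def)
  note [measurable] = measurable_circle_continuous[OF s_cont]
  have s_coeff: "fourier_coeff (s N) m = d m" if "\<bar>m\<bar> \<le> int N" for N m
  proof -
    have "complex_of_real (s N x) * fourier_char (- m) x =
        (\<Sum>n\<in>{- int N..int N}. d n * fourier_char (n - m) x)" for x
      unfolding P_real P_def sum_distrib_right
      using fourier_char_add[of _ "- m" x] by (simp add: mult.assoc)
    then have "fourier_coeff (s N) m =
        (\<Sum>n\<in>{- int N..int N}. d n * (\<integral>x. fourier_char (n - m) x \<partial>circle_measure))"
      unfolding fourier_coeff_def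
      by (simp add: integrable_circle_continuous continuous_on_fourier_char)
    also have "\<dots> = d m"
      using that by (auto simp: integral_fourier_char if_distrib abs_le_iff cong: if_cong)
    finally show ?thesis .
  qed
  have dist: "(\<integral>x. (s N x - s M x)\<^sup>2 \<partial>circle_measure) \<le> T M" if "M \<le> N" for M N
  proof -
    let ?S = "{- int N..int N} - {- int M..int M}"
    have "(s N x - s M x)\<^sup>2 = (cmod (\<Sum>n\<in>?S. d n * fourier_char n x))\<^sup>2" for x
    proof -
      have "(\<Sum>n\<in>?S. d n * fourier_char n x) = P N x - P M x"
        unfolding P_def using that by (intro sum_diff) auto
      also have "\<dots> = complex_of_real (s N x - s M x)"
        by (simp add: P_real)
      finally show ?thesis
        by (simp only: norm_of_real power2_abs)
    qed
    then have "(\<integral>x. (s N x - s M x)\<^sup>2 \<partial>circle_measure) =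
        (\<integral>x. (cmod (\<Sum>n\<in>?S. d n * fourier_char n x))\<^sup>2 \<partial>circle_measure)"
      by presburger
    also have "\<dots> = (\<Sum>n\<in>?S. (cmod (d n))\<^sup>2)"
      by (rule integral_norm_trig_poly_square) simp
    also have "\<dots> = (\<Sum>n\<in>{- int N..int N}. (cmod (d n))\<^sup>2) - (\<Sum>n\<in>{- int M..int M}. (cmod (d n))\<^sup>2)"
      using that by (intro sum_diff) auto
    also have "\<dots> \<le> T M"
      unfolding T_def D_def using d(2) by (auto intro!: finite_sum_le_infsum)
    finally show ?thesis .
  qed
  have sq_int: "integrable circle_measure (\<lambda>x. (s N x - s M x)\<^sup>2)" for N M
    by (intro integrable_circle_continuous continuous_intros s_cont)
  have dist_L1: "(\<integral>x. norm (s N x - s M x) \<partial>circle_measure) < e"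
    if "e > 0" "M \<le> N" "T M < e\<^sup>2" for e M N
  proof -
    \<comment> \<open>The weights come from expanding (e - |u|)^2 >= 0 for u =
      \<open>s N x - s M x\<close>; if the integral of u^2 is below e^2, the two halves add up to
      less than \<open>e\<close>.\<close>
    have "(\<integral>x. norm (s N x - s M x) \<partial>circle_measure) \<le>
          (\<integral>x. e / 2 + (s N x - s M x)\<^sup>2 / (2 * e) \<partial>circle_measure)"
    proof (rule integral_mono)
      show "integrable circle_measure (\<lambda>x. norm (s N x - s M x))"
        by (intro integrable_circle_continuous continuous_intros s_cont)
      show "integrable circle_measure (\<lambda>x. e / 2 + (s N x - s M x)\<^sup>2 / (2 * e))"
        using sq_int by auto
      fix x
      have "0 \<le> (e - \<bar>s N x - s M x\<bar>)\<^sup>2"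
        by simp
      then have "2 * e * \<bar>s N x - s M x\<bar> \<le> e\<^sup>2 + (s N x - s M x)\<^sup>2"
        by (simp add: power2_diff)
      then show "norm (s N x - s M x) \<le> e / 2 + (s N x - s M x)\<^sup>2 / (2 * e)"
        using \<open>e > 0\<close> by (simp add: field_simps power2_eq_square)
    qed
    also have "\<dots> = e / 2 + (\<integral>x. (s N x - s M x)\<^sup>2 \<partial>circle_measure) / (2 * e)"
      using sq_int[of N M] by simp
    also have "\<dots> \<le> e / 2 + T M / (2 * e)"
      using dist[OF that(2)] that(1) by (intro add_left_mono divide_right_mono) auto
    also have "\<dots> < e / 2 + e\<^sup>2 / (2 * e)"
      using that by (intro add_strict_left_mono divide_strict_right_mono) auto
    also have "\<dots> = e"
      using that by (simp add: field_simps power2_eq_square)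
    finally show ?thesis .
  qed
  obtain r where r: "strict_mono r" "AE x in circle_measure. Cauchy (\<lambda>i. s (r i) x)"
  proof (rule cauchy_L1_AE_cauchy_subseq[of circle_measure s])
    show "integrable circle_measure (s n)" for n
      by (intro integrable_circle_continuous s_cont)
    fix e :: real assume "e > 0"
    then have "\<forall>\<^sub>F n in sequentially. T n < (e / 2)\<^sup>2"
      using T_lim by (intro order_tendstoD) auto
    then obtain K where K: "T K < (e / 2)\<^sup>2"
      by (auto simp: eventually_sequentially)
    have "(\<integral>x. norm (s i x - s j x) \<partial>circle_measure) < e" if "i \<ge> K" "j \<ge> K" for i j
    proof -
      have "(\<integral>x. norm (s i x - s j x) \<partial>circle_measure) \<le>
            (\<integral>x. norm (s i x - s K x) + norm (s j x - s K x) \<partial>circle_measure)"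
        by (intro integral_mono integrable_circle_continuous continuous_intros s_cont) auto
      also have "\<dots> = (\<integral>x. norm (s i x - s K x) \<partial>circle_measure) + (\<integral>x. norm (s j x - s K x) \<partial>circle_measure)"
        by (intro Bochner_Integration.integral_add integrable_circle_continuous continuous_intros s_cont)
      also have "\<dots> < e / 2 + e / 2"
        using K that \<open>e > 0\<close> by (intro add_strict_mono dist_L1) auto
      finally show ?thesis
        by simp
    qed
    then show "\<exists>N. \<forall>i\<ge>N. \<forall>j\<ge>N. (\<integral>x. norm (s i x - s j x) \<partial>circle_measure) < e"
      by blast
  qed blast
  \<comment> \<open>\<open>lim\<close> depends only on the sequence of values, so \<open>g\<close>
    is periodic everywhere, including points where the sequence diverges.\<close>
  define g where "g x = lim (\<lambda>i. s (r i) x)" for x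
  have g_lim: "AE x in circle_measure. (\<lambda>i. s (r i) x) \<longlonglongrightarrow> g x"
    using r(2) by eventually_elim (simp add: g_def Cauchy_convergent_iff convergent_LIMSEQ_iff)
  have [measurable]: "g \<in> borel_measurable circle_measure"
    unfolding g_def by measurable
  have T_nonneg: "T M \<ge> 0" for M
    using dist[of M M] by simp
  have fatou: "(\<integral>\<^sup>+x. ennreal ((g x - s M x)\<^sup>2) \<partial>circle_measure) \<le> ennreal (T M)" for M
  proof -
    have "(\<integral>\<^sup>+x. ennreal ((g x - s M x)\<^sup>2) \<partial>circle_measure) =
          (\<integral>\<^sup>+x. liminf (\<lambda>i. ennreal ((s (r i) x - s M x)\<^sup>2)) \<partial>circle_measure)"
    proof (rule nn_integral_cong_AE)
      show "AE x in circle_measure.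
          ennreal ((g x - s M x)\<^sup>2) = liminf (\<lambda>i. ennreal ((s (r i) x - s M x)\<^sup>2))"
        using g_lim
      proof eventually_elim
        case (elim x)
        then have "(\<lambda>i. ennreal ((s (r i) x - s M x)\<^sup>2)) \<longlonglongrightarrow> ennreal ((g x - s M x)\<^sup>2)"
          by (intro tendsto_ennrealI tendsto_intros)
        then show ?case
          by (intro lim_imp_Liminf[symmetric]) auto
      qed
    qed
    also have "\<dots> \<le> liminf (\<lambda>i. \<integral>\<^sup>+x. ennreal ((s (r i) x - s M x)\<^sup>2) \<partial>circle_measure)"
      by (intro nn_integral_liminf) measurable
    also have "\<dots> \<le> limsup (\<lambda>i. \<integral>\<^sup>+x. ennreal ((s (r i) x - s M x)\<^sup>2) \<partial>circle_measure)"
      by (rule Liminf_le_Limsup) simp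
    also have "\<dots> \<le> ennreal (T M)"
    proof (rule Limsup_bounded)
      have "(\<integral>\<^sup>+x. ennreal ((s (r i) x - s M x)\<^sup>2) \<partial>circle_measure) \<le> ennreal (T M)" if "i \<ge> M" for i
      proof -
        \<comment> \<open>A strictly increasing index sequence satisfies i <= \<open>r i\<close>, so
          the tail bound from \<open>M\<close> on applies to the subsequence.\<close>
        have "M \<le> r i"
          using that seq_suble[OF r(1), of i] by simp
        then show ?thesis
          using sq_int dist by (subst nn_integral_eq_integral) (auto intro!: ennreal_leI)
      qed
      then show "\<forall>\<^sub>F i in sequentially.
          (\<integral>\<^sup>+x. ennreal ((s (r i) x - s M x)\<^sup>2) \<partial>circle_measure) \<le> ennreal (T M)"
        unfolding eventually_sequentially by blast
    qed
    finally show ?thesis .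
  qed
  have gs_int: "integrable circle_measure (\<lambda>x. (g x - s M x)\<^sup>2)" for M
  proof (rule integrableI_bounded)
    show "(\<integral>\<^sup>+x. ennreal (norm ((g x - s M x)\<^sup>2)) \<partial>circle_measure) < \<infinity>"
      using fatou[of M] by (simp add: le_less_trans)
  qed measurable
  have gs_le: "(\<integral>x. (g x - s M x)\<^sup>2 \<partial>circle_measure) \<le> T M" for M
    using fatou[of M] T_nonneg[of M] gs_int[of M] by (subst (asm) nn_integral_eq_integral) auto
  have g_circle: "circle_fun g"
    by (simp add: circle_fun_def g_def s_periodic)
  have gs_L2: "(\<lambda>x. g x - s M x) \<in> L2_circle" for M
    using gs_int g_circle s_periodic by (auto simp: L2_circle_def circle_fun_def)
  have g_L2: "g \<in> L2_circle"
  proof -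
    \<comment> \<open>A way to write \<open>g\<close> with differences only, so that closure of L2
      under subtraction is enough.\<close>
    have "(\<lambda>x. (g x - s 0 x) - (0 - s 0 x)) \<in> L2_circle"
      by (intro L2_circle_diff gs_L2 s_L2) (auto simp: L2_circle_def circle_fun_def)
    then show ?thesis
      by simp
  qed
  have coeff_diff: "fourier_coeff (\<lambda>x. g x - s N x) n = fourier_coeff g n - fourier_coeff (s N) n" for N n
    by (intro fourier_coeff_diff L2_circle_imp_integrable g_L2 s_L2)
  have g_coeff: "fourier_coeff g n = d n" for n
  proof -
    have "\<forall>\<^sub>F N in sequentially. (cmod (fourier_coeff g n - d n))\<^sup>2 \<le> T N"
      using eventually_ge_at_top[of "nat \<bar>n\<bar>"]
    proof eventually_elim
      case (elim N)
      \<comment> \<open>Once N >= |n|, the coefficient of \<open>s N\<close> at \<open>n\<close> is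
        already \<open>d n\<close>; Bessel for the single index \<open>n\<close> then bounds the
        discrepancy by the tail.\<close>
      then have "(cmod (fourier_coeff g n - d n))\<^sup>2 =
          (\<Sum>n\<in>{n}. (cmod (fourier_coeff (\<lambda>x. g x - s N x) n))\<^sup>2)"
        by (simp add: coeff_diff s_coeff)
      also have "\<dots> \<le> (\<integral>x. (g x - s N x)\<^sup>2 \<partial>circle_measure)"
        by (intro Bessel_finite gs_L2) auto
      also have "\<dots> \<le> T N"
        by (rule gs_le)
      finally show ?case .
    qed
    then have "(cmod (fourier_coeff g n - d n))\<^sup>2 \<le> 0"
      by (rule tendsto_lowerbound[OF T_lim]) simp
    then show ?thesis
      by simp
  qed
  \<comment> \<open>The sharp bound needs only the partial sum with the single frequency 0:
    Pythagoras and the distance bound leave \<open>T 0\<close>, which is \<open>D\<close> minus the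
    same term |d_0|^2.\<close>
  have "(\<integral>x. (g x)\<^sup>2 \<partial>circle_measure) - (\<Sum>n\<in>{- int 0..int 0}. (cmod (d n))\<^sup>2) =
        (\<integral>x. (g x - s 0 x)\<^sup>2 \<partial>circle_measure)"
  proof -
    have "(g x - s 0 x)\<^sup>2 = (cmod (complex_of_real (g x) - P 0 x))\<^sup>2" for x
      by (simp flip: P_real of_real_diff)
    then show ?thesis
      using integral_dist_trig_poly_square[OF g_L2 finite_atLeastAtMost_int, of "- int 0" "int 0"]
      unfolding P_def g_coeff by presburger
  qed
  also have "\<dots> \<le> T 0"
    by (rule gs_le)
  finally have "(\<integral>x. (g x)\<^sup>2 \<partial>circle_measure) \<le> D"
    by (simp add: T_def)
  with that g_L2 g_coeff show ?thesis
    by (simp add: D_def)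
qed

text \<open>Bessel gives one inequality. The function produced by Riesz-Fischer from the
  coefficients of \<open>f\<close> satisfies the opposite one, and it equals \<open>f\<close> almost
  everywhere by uniqueness.\<close>

theorem Parseval:
  assumes "f \<in> L2_circle"
  shows "(norm2 f)\<^sup>2 = (\<Sum>\<^sub>\<infinity>n. (cmod (fourier_coeff f n))\<^sup>2)"
proof -
  obtain g where g: "g \<in> L2_circle" "\<And>n. fourier_coeff g n = fourier_coeff f n"
     "(\<integral>x. (g x)\<^sup>2 \<partial>circle_measure) \<le> (\<Sum>\<^sub>\<infinity>n. (cmod (fourier_coeff f n))\<^sup>2)"
    using Riesz_Fischer[OF hermitian_fourier_coeff Bessel(1)[OF assms]] by blast
  have "AE x in circle_measure. f x = g x"
    by (intro fourier_coeff_inject_AE L2_circle_imp_integrable assms g(1) g(2)[symmetric])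
  then have "(\<integral>x. (f x)\<^sup>2 \<partial>circle_measure) = (\<integral>x. (g x)\<^sup>2 \<partial>circle_measure)"
    using assms g(1) by (intro integral_cong_AE) (auto simp: L2_circle_def)
  then show ?thesis
    using g(3) Bessel(2)[OF assms] by (simp add: norm2_def)
qed

section \<open>Weak derivatives\<close>

lemma summable_on_le:
  fixes f g :: "'a \<Rightarrow> real"
  assumes "g summable_on A" "\<And>x. x \<in> A \<Longrightarrow> 0 \<le> f x" "\<And>x. x \<in> A \<Longrightarrow> f x \<le> g x"
  shows "f summable_on A"
proof -
  have "(\<lambda>x. norm (f x)) summable_on A"
    by (rule Infinite_Sum.abs_summable_on_comparison_test'[OF assms(1)]) (use assms in auto)
  then show ?thesis
    by (rule summable_on_cong[THEN iffD1, rotated]) (use assms in auto)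
qed

lemma summable_on_inverse_int_squares: "(\<lambda>n::int. inverse ((of_int n)\<^sup>2) :: real) summable_on UNIV"
proof -
  let ?f = "\<lambda>n::int. inverse ((of_int n)\<^sup>2) :: real"
  have nat: "(\<lambda>n::nat. inverse ((real n)\<^sup>2)) summable_on UNIV"
    by (intro summable_nonneg_imp_summable_on inverse_power_summable) auto
  have "?f summable_on range int"
    using nat by (subst summable_on_reindex) (auto simp: o_def)
  moreover have "?f summable_on range (\<lambda>n. - int (Suc n))"
  proof -
    have "(\<lambda>n::nat. inverse ((real (Suc n))\<^sup>2)) summable_on UNIV"
      using summable_Suc_iff[of "\<lambda>n. inverse ((real n)\<^sup>2)"] inverse_power_summable[of 2, where 'a = real]
      by (intro summable_nonneg_imp_summable_on) auto
    then show ?thesis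
      by (subst summable_on_reindex) (auto simp: o_def inj_on_def simp del: of_nat_Suc)
  qed
  moreover have "range int \<inter> range (\<lambda>n. - int (Suc n)) = {}"
    by auto
  ultimately have "?f summable_on (range int \<union> range (\<lambda>n. - int (Suc n)))"
    by (rule summable_on_Un_disjoint)
  moreover have "n \<in> range int \<union> range (\<lambda>n. - int (Suc n))" for n
    by (cases n) auto
  then have "range int \<union> range (\<lambda>n. - int (Suc n)) = UNIV"
    by blast
  ultimately show ?thesis
    by simp
qed

text \<open>By the inequality of the means, |b_n| = |n b_n| * (1/|n|) is at most |n b_n|^2 + 1/n^2
  for nonzero n.\<close>

lemma summable_norm_if_square_summable:
  assumes "(\<lambda>n. (cmod (of_int n * b n))\<^sup>2) summable_on UNIV"
  shows "(\<lambda>n::int. cmod (b n)) summable_on UNIV"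
proof -
  \<comment> \<open>The last summand provides for n = 0, where the other two are zero because
    \<open>inverse 0 = 0\<close>.\<close>
  have "(\<lambda>n. (cmod (of_int n * b n))\<^sup>2 + inverse ((of_int n)\<^sup>2) + (if n = 0 then cmod (b 0) else 0)) summable_on UNIV"
  proof (intro summable_on_add assms summable_on_inverse_int_squares)
    show "(\<lambda>n::int. if n = 0 then cmod (b 0) else 0) summable_on UNIV"
      by (subst summable_on_cong_neutral[of "{0}" UNIV "\<lambda>_. cmod (b 0)"]) auto
  qed
  then show ?thesis
  proof (rule summable_on_le)
    fix n :: int
    show "cmod (b n) \<le> (cmod (of_int n * b n))\<^sup>2 + inverse ((of_int n)\<^sup>2) + (if n = 0 then cmod (b 0) else 0)"
    proof (cases "n = 0")
      case False
      define t where "t = \<bar>real_of_int n\<bar>"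
      define u where "u = t * cmod (b n)"
      have t: "t > 0"
        using False by (simp add: t_def)
      have u: "u \<ge> 0"
        using t by (simp add: u_def)
      have "0 \<le> (u - inverse t)\<^sup>2"
        by simp
      then have "2 * (u * inverse t) \<le> u\<^sup>2 + (inverse t)\<^sup>2"
        by (simp add: power2_diff)
      moreover have "0 \<le> u * inverse t"
        using u t by simp
      ultimately have "u * inverse t \<le> u\<^sup>2 + (inverse t)\<^sup>2"
        by linarith
      moreover have "u * inverse t = cmod (b n)"
        using t by (simp add: u_def)
      moreover have "u = cmod (of_int n * b n)"
        by (simp add: u_def t_def norm_mult)
      moreover have "(inverse t)\<^sup>2 = inverse ((of_int n)\<^sup>2)"
        by (simp add: t_def power_inverse)
      ultimately show ?thesis
        using False by simp
    qed simp
  qed simp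
qed

section \<open>Classical derivatives and their coefficients\<close>

lemma deriv_periodic: "circle_fun f \<Longrightarrow> circle_fun (deriv f)" for f :: "real \<Rightarrow> real"
  by (simp add: circle_fun_def deriv_def DERIV_shift)

lemma Ck_circle_1D:
  assumes "f \<in> Ck_circle 1"
  shows "circle_fun f" "(f has_real_derivative deriv f x) (at x)" "continuous_on UNIV (deriv f)"
    "continuous_on UNIV f"
proof -
  show "circle_fun f" "continuous_on UNIV (deriv f)"
    using assms by (auto simp: Ck_circle_def)
  show D: "(f has_real_derivative deriv f x) (at x)" for x
    using assms by (auto simp: Ck_circle_def DERIV_deriv_iff_real_differentiable)
  show "continuous_on UNIV f"
    by (intro continuous_at_imp_continuous_on ballI DERIV_isCont[OF D])
qed

text \<open>\<open>Ck_circle\<close> asks for continuity of the top derivative only; the lower ones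
  are continuous because they are differentiable.\<close>

lemma Ck_circle_Suc_imp_1:
  assumes "f \<in> Ck_circle (Suc k)"
  shows "f \<in> Ck_circle 1"
proof (cases k)
  case 0
  then show ?thesis
    using assms by simp
next
  case (Suc l)
  then have "deriv f differentiable (at x)" for x
    using assms unfolding Ck_circle_def by (force dest: spec[of _ 1])
  then have "continuous_on UNIV (deriv f)"
    by (intro continuous_at_imp_continuous_on ballI differentiable_imp_continuous_within)
  moreover have "(deriv ^^ 0) f differentiable (at x)" for x
    using assms unfolding Ck_circle_def by blast
  ultimately show ?thesis
    using assms by (simp add: Ck_circle_def)
qed

lemma deriv_in_Ck_circle:
  assumes "f \<in> Ck_circle (Suc k)"
  shows "deriv f \<in> Ck_circle k"
proof -
  have eq: "(deriv ^^ j) (deriv f) = (deriv ^^ Suc j) f" for j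
    by (simp add: funpow_swap1)
  have "(deriv ^^ j) (deriv f) differentiable (at x)" if "j < k" for j x
    unfolding eq using assms that unfolding Ck_circle_def by blast
  moreover have "continuous_on UNIV ((deriv ^^ k) (deriv f))"
    unfolding eq using assms unfolding Ck_circle_def by blast
  moreover have "circle_fun (deriv f)"
    using assms by (auto simp: Ck_circle_def intro: deriv_periodic)
  ultimately show ?thesis
    unfolding Ck_circle_def by blast
qed

lemma funpow_deriv_in_Ck_circle:
  "f \<in> Ck_circle (j + k) \<Longrightarrow> (deriv ^^ j) f \<in> Ck_circle k"
proof (induction j arbitrary: f)
  case (Suc j)
  then have "(deriv ^^ j) (deriv f) \<in> Ck_circle k"
    using deriv_in_Ck_circle[of f "j + k"] by simp
  then show ?case
    by (simp add: funpow_swap1)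
qed simp

lemma Ck_circle_0_imp_L2_circle: "f \<in> Ck_circle 0 \<Longrightarrow> f \<in> L2_circle"
  by (rule continuous_imp_L2_circle) (auto simp: Ck_circle_def)

text \<open>Integration by parts, carried out as the fundamental theorem of calculus for
  \<open>f\<close> times a character; the boundary terms cancel by periodicity.\<close>

lemma fourier_coeff_deriv:
  assumes "f \<in> Ck_circle 1"
  shows "fourier_coeff (deriv f) n = 2 * pi * \<i> * of_int n * fourier_coeff f n"
proof -
  define w where "w = 2 * pi * \<i> * of_int n"
  note f = Ck_circle_1D[OF assms]
  define F where "F x = complex_of_real (f x) * fourier_char (- n) x" for x
  define F' where "F' x = complex_of_real (deriv f x) * fourier_char (- n) x - w * F x" for x
  have fi: "integrable circle_measure f" and f'i: "integrable circle_measure (deriv f)"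
    by (intro integrable_circle_continuous f)+
  have "((\<lambda>x. complex_of_real (f x) * fourier_char (- n) x) has_vector_derivative
      complex_of_real (f x) * ((2 * pi * \<i> * of_int (- n)) * fourier_char (- n) x)
        + complex_of_real (deriv f x) * fourier_char (- n) x) (at x)" for x
    by (intro has_vector_derivative_mult has_vector_derivative_of_real f has_vector_derivative_fourier_char)
  then have "(F has_vector_derivative F' x) (at x)" for x
    by (simp add: F_def[abs_def] F'_def w_def algebra_simps)
  moreover have "continuous_on UNIV F'"
    unfolding F'_def F_def by (intro continuous_intros f)
  ultimately have "(\<integral>x. F' x \<partial>circle_measure) = F 1 - F 0"
    by (rule integral_circle_FTC)
  also have "F 1 = F 0"
    using f(1) fourier_char_periodic[of "- n" 0] unfolding F_def circle_fun_def
    by (metis add_0)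
  also have "(\<integral>x. F' x \<partial>circle_measure) = fourier_coeff (deriv f) n - w * fourier_coeff f n"
    unfolding F'_def F_def fourier_coeff_def
    using integrable_mult_fourier_char[OF fi] integrable_mult_fourier_char[OF f'i] by simp
  finally show ?thesis
    by (simp add: w_def)
qed

lemma fourier_coeff_funpow_deriv:
  "f \<in> Ck_circle j \<Longrightarrow> fourier_coeff ((deriv ^^ j) f) n = (2 * pi * \<i> * of_int n) ^ j * fourier_coeff f n"
proof (induction j arbitrary: f)
  case (Suc j)
  have "fourier_coeff ((deriv ^^ j) (deriv f)) n = (2 * pi * \<i> * of_int n) ^ j * fourier_coeff (deriv f) n"
    by (intro Suc.IH deriv_in_Ck_circle Suc.prems)
  also have "fourier_coeff (deriv f) n = 2 * pi * \<i> * of_int n * fourier_coeff f n"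
    by (intro fourier_coeff_deriv Ck_circle_Suc_imp_1[OF Suc.prems])
  finally show ?case
    by (simp add: funpow_swap1 mult_ac)
qed simp

lemma norm_two_pi_i_mult: "cmod (2 * pi * \<i> * of_int n * z) = 2 * pi * cmod (of_int n * z)"
  by (simp add: norm_mult)

lemma summable_norm_if_deriv_square_summable:
  assumes "(\<lambda>n. (cmod (2 * pi * \<i> * of_int n * b n))\<^sup>2) summable_on UNIV"
  shows "(\<lambda>n::int. cmod (b n)) summable_on UNIV"
proof (rule summable_norm_if_square_summable)
  have "(\<lambda>n. (2 * pi)\<^sup>2 * (cmod (of_int n * b n))\<^sup>2) summable_on UNIV"
    using assms by (simp only: norm_two_pi_i_mult power_mult_distrib)
  then show "(\<lambda>n. (cmod (of_int n * b n))\<^sup>2) summable_on UNIV"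
    by (subst (asm) summable_on_cmult_right') auto
qed

lemma Ck_circle_1_summable_fourier_coeff:
  assumes "f \<in> Ck_circle 1"
  shows "(\<lambda>n. cmod (fourier_coeff f n)) summable_on UNIV"
proof (rule summable_norm_if_deriv_square_summable)
  have "deriv f \<in> L2_circle"
    using assms by (intro Ck_circle_0_imp_L2_circle deriv_in_Ck_circle) simp
  then show "(\<lambda>n. (cmod (2 * pi * \<i> * of_int n * fourier_coeff f n))\<^sup>2) summable_on UNIV"
    using Bessel(1)[of "deriv f"] by (simp only: fourier_coeff_deriv[OF assms])
qed

text \<open>Test functions are real, so characters can serve as test functions only through their
  real parts; the free complex factor \<open>w\<close> makes up for the lost imaginary part.\<close>

lemma has_real_derivative_Re_fourier_char:
  "((\<lambda>x. Re (w * fourier_char n x)) has_real_derivative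
     Re (w * (2 * pi * \<i> * of_int n) * fourier_char n x)) (at x)"
proof -
  have "((\<lambda>x. Re (w * fourier_char n x)) has_vector_derivative
     Re (w * ((2 * pi * \<i> * of_int n) * fourier_char n x))) (at x)"
    by (intro bounded_linear.has_vector_derivative[OF bounded_linear_Re]
        has_vector_derivative_mult_right has_vector_derivative_fourier_char)
  then show ?thesis
    by (simp only: has_real_derivative_iff_has_vector_derivative mult.assoc)
qed

lemma funpow_deriv_Re_fourier_char:
  "(deriv ^^ j) (\<lambda>x. Re (w * fourier_char n x)) =
     (\<lambda>x. Re (w * (2 * pi * \<i> * of_int n) ^ j * fourier_char n x))"
proof (induction j)
  case (Suc j)
  have "(deriv ^^ Suc j) (\<lambda>x. Re (w * fourier_char n x)) =
        deriv (\<lambda>x. Re (w * (2 * pi * \<i> * of_int n) ^ j * fourier_char n x))"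
    by (simp only: funpow.simps comp_apply Suc.IH)
  also have "\<dots> = (\<lambda>x. Re (w * (2 * pi * \<i> * of_int n) ^ j * (2 * pi * \<i> * of_int n) * fourier_char n x))"
    by (intro ext DERIV_imp_deriv has_real_derivative_Re_fourier_char)
  finally show ?case
    by (simp only: power_Suc2 mult.assoc)
qed simp

lemma Re_fourier_char_in_Ck_circle: "(\<lambda>x. Re (w * fourier_char n x)) \<in> Ck_circle k"
  unfolding Ck_circle_def
proof (intro CollectI conjI allI impI)
  show "circle_fun (\<lambda>x. Re (w * fourier_char n x))"
    by (simp add: circle_fun_def fourier_char_periodic)
  show "(deriv ^^ j) (\<lambda>x. Re (w * fourier_char n x)) differentiable (at x)" for j x
    unfolding funpow_deriv_Re_fourier_char
    using has_real_derivative_Re_fourier_char real_differentiable_def by blast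
  show "continuous_on UNIV ((deriv ^^ k) (\<lambda>x. Re (w * fourier_char n x)))"
    unfolding funpow_deriv_Re_fourier_char by (intro continuous_intros)
qed

lemma integral_mult_Re_fourier_char:
  assumes "integrable circle_measure f"
  shows "(\<integral>x. f x * Re (w * fourier_char n x) \<partial>circle_measure) = Re (w * fourier_coeff f (- n))"
proof -
  have "integrable circle_measure (\<lambda>x. w * (complex_of_real (f x) * fourier_char n x))"
    by (intro integrable_mult_right integrable_mult_fourier_char assms)
  then have "(\<integral>x. Re (w * (complex_of_real (f x) * fourier_char n x)) \<partial>circle_measure) =
        Re (\<integral>x. w * (complex_of_real (f x) * fourier_char n x) \<partial>circle_measure)"
    by (rule integral_Re)
  then show ?thesis
    by (simp add: fourier_coeff_def algebra_simps)
qed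

text \<open>Forwards, the test functions \<open>Re (w * fourier_char (- n) x)\<close> isolate a
  single coefficient. Backwards, a test function and its derivatives have absolutely summable
  coefficients, so both integrals expand into sums that agree term by term, the sign
  \<open>(- 1) ^ j\<close> arising from the passage from n to -n.\<close>

theorem is_weak_deriv_iff_fourier_coeff:
  assumes f: "integrable circle_measure f"
  shows "is_weak_deriv j f g \<longleftrightarrow>
    g \<in> L1_circle \<and> (\<forall>n. fourier_coeff g n = (2 * pi * \<i> * of_int n) ^ j * fourier_coeff f n)"
proof (intro iffI conjI allI)
  assume L: "is_weak_deriv j f g"
  then show g: "g \<in> L1_circle"
    by (simp add: is_weak_deriv_def)
  then have gi: "integrable circle_measure g"
    by (simp add: L1_circle_def)
  fix n
  define z where "z = fourier_coeff g n - (2 * pi * \<i> * of_int n) ^ j * fourier_coeff f n"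
  have "Re (w * z) = 0" for w
  proof -
    have "(\<lambda>x. Re (w * fourier_char (- n) x)) \<in> (\<Inter>k. Ck_circle k)"
      by (intro INT_I Re_fourier_char_in_Ck_circle)
    then have "(\<integral>x. f x * (deriv ^^ j) (\<lambda>x. Re (w * fourier_char (- n) x)) x \<partial>circle_measure) =
        (- 1) ^ j * (\<integral>x. g x * Re (w * fourier_char (- n) x) \<partial>circle_measure)"
      using L unfolding is_weak_deriv_def by blast
    then have "Re (w * (2 * pi * \<i> * of_int (- n)) ^ j * fourier_coeff f n) =
        (- 1) ^ j * Re (w * fourier_coeff g n)"
      unfolding funpow_deriv_Re_fourier_char by (simp only: integral_mult_Re_fourier_char f gi minus_minus)
    moreover have "(2 * pi * \<i> * of_int (- n)) ^ j = (- 1) ^ j * (2 * pi * \<i> * of_int n) ^ j"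
      by (simp flip: power_mult_distrib)
    ultimately show ?thesis
      by (cases "even j") (auto simp: z_def algebra_simps)
  qed
  \<comment> \<open>This choice of \<open>w\<close> turns the real part into |z|^2.\<close>
  from this[of "cnj z"] have "z = 0"
    by (simp add: complex_eq_iff flip: power2_eq_square)
  then show "fourier_coeff g n = (2 * pi * \<i> * of_int n) ^ j * fourier_coeff f n"
    by (simp add: z_def)
next
  assume R: "g \<in> L1_circle \<and> (\<forall>n. fourier_coeff g n = (2 * pi * \<i> * of_int n) ^ j * fourier_coeff f n)"
  then have gi: "integrable circle_measure g"
    by (simp add: L1_circle_def)
  have "(\<integral>x. f x * (deriv ^^ j) \<phi> x \<partial>circle_measure) = (- 1) ^ j * (\<integral>x. g x * \<phi> x \<partial>circle_measure)"
    if \<phi>: "\<phi> \<in> (\<Inter>k. Ck_circle k)" for \<phi>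
  proof -
    have \<phi>1: "\<phi> \<in> Ck_circle 1" and \<phi>j: "\<phi> \<in> Ck_circle j" and \<phi>j1: "(deriv ^^ j) \<phi> \<in> Ck_circle 1"
      using \<phi> funpow_deriv_in_Ck_circle by blast+
    have "complex_of_real (\<integral>x. f x * (deriv ^^ j) \<phi> x \<partial>circle_measure) =
          (\<Sum>\<^sub>\<infinity>n. fourier_coeff ((deriv ^^ j) \<phi>) n * fourier_coeff f (- n))"
      by (intro integral_mult_eq_infsum_fourier_coeff f Ck_circle_1D(4)
            Ck_circle_1_summable_fourier_coeff \<phi>j1)
    also have "\<dots> = (\<Sum>\<^sub>\<infinity>n. (- 1) ^ j * (fourier_coeff \<phi> n * fourier_coeff g (- n)))"
    proof (rule infsum_cong)
      fix n
      have "(2 * pi * \<i> * of_int (- n)) ^ j = (- 1) ^ j * (2 * pi * \<i> * of_int n) ^ j"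
        by (simp flip: power_mult_distrib)
      then have "(2 * pi * \<i> * of_int n) ^ j = (- 1) ^ j * (2 * pi * \<i> * of_int (- n)) ^ j"
        by (cases "even j") auto
      then show "fourier_coeff ((deriv ^^ j) \<phi>) n * fourier_coeff f (- n) =
          (- 1) ^ j * (fourier_coeff \<phi> n * fourier_coeff g (- n))"
        using R \<phi>j by (simp add: fourier_coeff_funpow_deriv)
    qed
    also have "\<dots> = (- 1) ^ j * (\<Sum>\<^sub>\<infinity>n. fourier_coeff \<phi> n * fourier_coeff g (- n))"
      by (rule infsum_cmult_right')
    also have "(\<Sum>\<^sub>\<infinity>n. fourier_coeff \<phi> n * fourier_coeff g (- n)) =
        complex_of_real (\<integral>x. g x * \<phi> x \<partial>circle_measure)"
      by (intro integral_mult_eq_infsum_fourier_coeff[symmetric] gi Ck_circle_1D(4)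
            Ck_circle_1_summable_fourier_coeff \<phi>1)
    finally have "complex_of_real (\<integral>x. f x * (deriv ^^ j) \<phi> x \<partial>circle_measure) =
        complex_of_real ((- 1) ^ j * (\<integral>x. g x * \<phi> x \<partial>circle_measure))"
      by simp
    then show ?thesis
      by (simp only: of_real_eq_iff)
  qed
  then show "is_weak_deriv j f g"
    using R by (simp add: is_weak_deriv_def)
qed

text \<open>The choice operator in \<open>weak_deriv\<close> returns some integrable weak
  derivative. It shares its coefficients with the square integrable one provided by
  \<open>Hk_circle\<close>, so the two agree almost everywhere and the chosen one inherits square
  integrability.\<close>

lemma weak_deriv_Hk_circle:
  assumes "f \<in> Hk_circle k" "j \<le> k"
  shows "weak_deriv j f \<in> L2_circle"
    and "fourier_coeff (weak_deriv j f) n = (2 * pi * \<i> * of_int n) ^ j * fourier_coeff f n"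
proof -
  have fi: "integrable circle_measure f"
    using assms by (intro L2_circle_imp_integrable) (simp add: Hk_circle_def)
  obtain g where g: "g \<in> L2_circle" "is_weak_deriv j f g"
    using assms unfolding Hk_circle_def by blast
  have "is_weak_deriv j f (weak_deriv j f)"
    unfolding weak_deriv_def by (rule someI[of "is_weak_deriv j f"]) (rule g(2))
  then have w: "weak_deriv j f \<in> L1_circle"
      "\<And>n. fourier_coeff (weak_deriv j f) n = (2 * pi * \<i> * of_int n) ^ j * fourier_coeff f n"
    using is_weak_deriv_iff_fourier_coeff[OF fi] by blast+
  then show "fourier_coeff (weak_deriv j f) n = (2 * pi * \<i> * of_int n) ^ j * fourier_coeff f n"
    by blast
  have wi: "integrable circle_measure (weak_deriv j f)" "circle_fun (weak_deriv j f)"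
    using w by (auto simp: L1_circle_def)
  have "fourier_coeff g n = (2 * pi * \<i> * of_int n) ^ j * fourier_coeff f n" for n
    using g(2) is_weak_deriv_iff_fourier_coeff[OF fi] by blast
  then have "AE x in circle_measure. g x = weak_deriv j f x"
    by (intro fourier_coeff_inject_AE L2_circle_imp_integrable g wi) (simp add: w)
  then have "integrable circle_measure (\<lambda>x. (weak_deriv j f x)\<^sup>2)"
    using L2_circleD[OF g(1)] borel_measurable_integrable[OF wi(1)]
    by (intro integrable_cong_AE_imp[OF L2_circleD(3)[OF g(1)]]) (auto elim!: eventually_mono)
  then show "weak_deriv j f \<in> L2_circle"
    using wi by (simp add: L2_circle_def)
qed

text \<open>Riesz-Fischer constructs the weak derivative of each order up to \<open>k\<close> from
  its prescribed coefficients; the intermediate orders are controlled by orders 0 and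
  \<open>k\<close>.\<close>

lemma Hk_circle_if_square_summable:
  assumes f: "f \<in> L2_circle"
    and "(\<lambda>n. (cmod ((2 * pi * \<i> * of_int n) ^ k * fourier_coeff f n))\<^sup>2) summable_on UNIV"
  shows "f \<in> Hk_circle k"
proof -
  have "\<exists>g \<in> L2_circle. is_weak_deriv j f g" if "j \<le> k" for j
  proof -
    define d where "d n = (2 * pi * \<i> * of_int n) ^ j * fourier_coeff f n" for n
    have "hermitian_seq d"
      by (simp add: hermitian_seq_def d_def fourier_coeff_minus)
    moreover have "(\<lambda>n. (cmod (d n))\<^sup>2) summable_on UNIV"
    proof (rule summable_on_le)
      show "(\<lambda>n. (cmod (fourier_coeff f n))\<^sup>2 +
          (cmod ((2 * pi * \<i> * of_int n) ^ k * fourier_coeff f n))\<^sup>2) summable_on UNIV"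
        by (intro summable_on_add assms Bessel f)
      fix n
      define t where "t = cmod (2 * pi * \<i> * of_int n)"
      \<comment> \<open>For t <= 1 the constant dominates, for t > 1 the higher power does.\<close>
      have "(t ^ j)\<^sup>2 \<le> 1 + (t ^ k)\<^sup>2"
      proof (cases "t \<le> 1")
        case True
        then have "t ^ j \<le> 1"
          by (intro power_le_one) (auto simp: t_def)
        moreover have "0 \<le> t ^ j"
          by (simp add: t_def)
        ultimately have "(t ^ j)\<^sup>2 \<le> 1"
          using power_le_one[of "t ^ j" 2] by simp
        then show ?thesis
          using zero_le_power2[of "t ^ k"] by linarith
      next
        case False
        then have "t ^ j \<le> t ^ k"
          using that by (intro power_increasing) auto
        then have "(t ^ j)\<^sup>2 \<le> (t ^ k)\<^sup>2"
          by (intro power_mono) (auto simp: t_def)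
        then show ?thesis
          by linarith
      qed
      then have "(t ^ j)\<^sup>2 * (cmod (fourier_coeff f n))\<^sup>2 \<le> (1 + (t ^ k)\<^sup>2) * (cmod (fourier_coeff f n))\<^sup>2"
        by (rule mult_right_mono) simp
      then show "(cmod (d n))\<^sup>2 \<le> (cmod (fourier_coeff f n))\<^sup>2 +
          (cmod ((2 * pi * \<i> * of_int n) ^ k * fourier_coeff f n))\<^sup>2"
        unfolding d_def norm_mult[of "_ ^ _"] norm_power t_def[symmetric]
        by (simp add: power_mult_distrib ring_distribs)
    qed simp
    ultimately obtain g where "g \<in> L2_circle" "\<And>n. fourier_coeff g n = d n"
      using Riesz_Fischer by blast
    then show ?thesis
      using is_weak_deriv_iff_fourier_coeff[OF L2_circle_imp_integrable[OF f]] L2_circle_imp_L1_circle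
      unfolding d_def by blast
  qed
  then show ?thesis
    using f by (simp add: Hk_circle_def)
qed

section \<open>The transfer operator and the solutions\<close>

text \<open>Rests on completeness of Lebesgue measure. It is needed for a function known only
  through its almost everywhere equality with a series.\<close>

lemma borel_measurable_circle_AE:
  fixes f g :: "real \<Rightarrow> real"
  assumes "f \<in> borel_measurable circle_measure" "AE x in circle_measure. f x = g x"
  shows "g \<in> borel_measurable circle_measure"
proof -
  have "(\<lambda>x. if x \<in> {0..<1} then f x else 0) \<in> borel_measurable lebesgue"
    using assms(1) unfolding circle_measure_def by (subst borel_measurable_if) auto
  moreover have "AE x in lebesgue. (if x \<in> {0..<1} then f x else 0) = (if x \<in> {0..<1} then g x else 0)"
    using assms(2) unfolding circle_measure_def
    by (subst (asm) AE_restrict_space_iff) (auto elim!: eventually_mono)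
  ultimately have "(\<lambda>x. if x \<in> {0..<1} then g x else 0) \<in> borel_measurable lebesgue"
    by (rule borel_measurable_AE)
  then show ?thesis
    unfolding circle_measure_def by (subst (asm) borel_measurable_if) auto
qed

text \<open>x/2 and (x+1)/2 are the inverse branches of the doubling map; they carry [0,1) onto its
  two halves, and each substitution doubles the integral over its half.\<close>

lemma integral_circle_halves:
  fixes h :: "real \<Rightarrow> 'b::euclidean_space"
  assumes h: "integrable circle_measure h"
  shows "integrable circle_measure (\<lambda>x. h (x / 2) + h ((x + 1) / 2))"
    and "(\<integral>x. h (x / 2) + h ((x + 1) / 2) \<partial>circle_measure) = 2 *\<^sub>R (\<integral>x. h x \<partial>circle_measure)"
proof -
  define I where "I = {0..<1::real}"
  define H where "H x = indicator I x *\<^sub>R h x" for x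
  define H1 where "H1 x = indicator {0..<1/2} x *\<^sub>R H x" for x
  define H2 where "H2 x = indicator {1/2..<1} x *\<^sub>R H x" for x
  have int_iff: "integrable circle_measure f \<longleftrightarrow> integrable lebesgue (\<lambda>x. indicator I x *\<^sub>R f x)"
    and int_eq: "(\<integral>x. f x \<partial>circle_measure) = (\<integral>x. indicator I x *\<^sub>R f x \<partial>lebesgue)" for f :: "real \<Rightarrow> 'b"
    unfolding circle_measure_def I_def by (simp_all add: integrable_restrict_space integral_restrict_space)
  have Hi: "integrable lebesgue H"
    using h unfolding int_iff H_def .
  have H1i: "integrable lebesgue H1" and H2i: "integrable lebesgue H2"
    unfolding H1_def H2_def by (intro integrable_mult_indicator Hi; simp)+
  have H_split: "H x = H1 x + H2 x" for x
    by (auto simp: H_def H1_def H2_def I_def indicator_def)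
  have H1_eq: "indicator I x *\<^sub>R h (x / 2) = H1 (0 + (1 / 2) * x)"
    and H2_eq: "indicator I x *\<^sub>R h ((x + 1) / 2) = H2 (1 / 2 + (1 / 2) * x)" for x
    by (auto simp: H_def H1_def H2_def I_def indicator_def add_divide_distrib add.commute)
  have h1: "integrable circle_measure (\<lambda>x. h (x / 2))"
    unfolding int_iff H1_eq by (rule lebesgue_integrable_real_affine[OF H1i]) simp
  have h2: "integrable circle_measure (\<lambda>x. h ((x + 1) / 2))"
    unfolding int_iff H2_eq by (rule lebesgue_integrable_real_affine[OF H2i]) simp
  show "integrable circle_measure (\<lambda>x. h (x / 2) + h ((x + 1) / 2))"
    using h1 h2 by simp
  have "(\<integral>x. h x \<partial>circle_measure) = (\<integral>x. H1 x + H2 x \<partial>lebesgue)"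
    unfolding int_eq H_split[symmetric] H_def ..
  also have "\<dots> = (\<integral>x. H1 x \<partial>lebesgue) + (\<integral>x. H2 x \<partial>lebesgue)"
    using H1i H2i by simp
  also have "(\<integral>x. H1 x \<partial>lebesgue) = (1 / 2) *\<^sub>R (\<integral>x. h (x / 2) \<partial>circle_measure)"
    unfolding int_eq H1_eq by (subst lebesgue_integral_real_affine[of "1 / 2" H1 0]) auto
  also have "(\<integral>x. H2 x \<partial>lebesgue) = (1 / 2) *\<^sub>R (\<integral>x. h ((x + 1) / 2) \<partial>circle_measure)"
    unfolding int_eq H2_eq by (subst lebesgue_integral_real_affine[of "1 / 2" H2 "1 / 2"]) auto
  finally show "(\<integral>x. h (x / 2) + h ((x + 1) / 2) \<partial>circle_measure) = 2 *\<^sub>R (\<integral>x. h x \<partial>circle_measure)"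
    using h1 h2 by (simp add: scaleR_add_right)
qed

lemma transfer_op_circle: "x \<in> {0..<1} \<Longrightarrow> transfer_op w x = (w (x / 2) + w ((x + 1) / 2)) / 2"
  by (simp add: transfer_op_eq frac_eq)

lemma integrable_transfer_op:
  assumes "integrable circle_measure w"
  shows "integrable circle_measure (transfer_op w)"
proof -
  have "integrable circle_measure (\<lambda>x. (w (x / 2) + w ((x + 1) / 2)) / 2)"
    using integral_circle_halves(1)[OF assms] by simp
  then show ?thesis
    by (rule Bochner_Integration.integrable_cong[THEN iffD2, rotated -1])
       (auto simp: transfer_op_circle)
qed

lemma fourier_coeff_transfer_op:
  assumes w: "integrable circle_measure w"
  shows "fourier_coeff (transfer_op w) n = fourier_coeff w (2 * n)"
proof -
  define h where "h x = complex_of_real (w x) * fourier_char (- (2 * n)) x" for x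
  have hi: "integrable circle_measure h"
    unfolding h_def by (rule integrable_mult_fourier_char[OF w])
  \<comment> \<open>Used at x and at x + 1: by periodicity the character of frequency -2n takes the
    same value on both branches and factors out.\<close>
  have e: "fourier_char (- (2 * n)) (x / 2) = fourier_char (- n) x" for x
    unfolding fourier_char_eq_cis by (rule arg_cong[of _ _ cis]) simp
  have "complex_of_real (transfer_op w x) * fourier_char (- n) x = (h (x / 2) + h ((x + 1) / 2)) / 2"
    if "x \<in> {0..<1}" for x
    using that unfolding h_def e fourier_char_periodic
    by (simp add: transfer_op_circle field_simps)
  then have "fourier_coeff (transfer_op w) n = (\<integral>x. (h (x / 2) + h ((x + 1) / 2)) / 2 \<partial>circle_measure)"
    unfolding fourier_coeff_def by (intro Bochner_Integration.integral_cong) auto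
  also have "\<dots> = (\<integral>x. h x \<partial>circle_measure)"
    using integral_circle_halves(2)[OF hi] by (simp add: scaleR_conv_of_real)
  finally show ?thesis
    by (simp add: fourier_coeff_def h_def)
qed

lemma solutions_iff:
  assumes \<rho>: "integrable circle_measure \<rho>"
  shows "\<epsilon> \<in> solutions \<rho> \<longleftrightarrow> \<epsilon> \<in> Hk_circle 1 \<and> fourier_coeff \<epsilon> 0 = 0 \<and>
    (\<forall>n. fourier_coeff \<rho> n - fourier_coeff \<rho> (2 * n) = - 2 * pi * \<i> * of_int n * fourier_coeff \<epsilon> (2 * n))"
proof (cases "\<epsilon> \<in> Hk_circle 1")
  case True
  define g where "g = weak_deriv 1 \<epsilon>"
  define h where "h y = - g y / 2" for y
  have g: "integrable circle_measure g" "\<And>n. fourier_coeff g n = 2 * pi * \<i> * of_int n * fourier_coeff \<epsilon> n"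
    using weak_deriv_Hk_circle[OF True order_refl] by (auto simp: g_def intro: L2_circle_imp_integrable)
  have h: "integrable circle_measure h"
    unfolding h_def using g(1) by simp
  have "fourier_coeff h n = - fourier_coeff g n / 2" for n
    unfolding fourier_coeff_def h_def by simp
  \<comment> \<open>The index 2n doubles the derivative factor to 4 pi i n, and the division by 2 in
    \<open>h\<close> brings it back.\<close>
  then have Lh: "fourier_coeff (transfer_op h) n = - 2 * pi * \<i> * of_int n * fourier_coeff \<epsilon> (2 * n)" for n
    by (simp add: fourier_coeff_transfer_op[OF h] g(2))
  have l: "integrable circle_measure (\<lambda>x. \<rho> x - transfer_op \<rho> x)"
    using \<rho> integrable_transfer_op[OF \<rho>] by simp
  have lc: "fourier_coeff (\<lambda>x. \<rho> x - transfer_op \<rho> x) n = fourier_coeff \<rho> n - fourier_coeff \<rho> (2 * n)" for n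
    using \<rho> by (simp add: fourier_coeff_diff integrable_transfer_op fourier_coeff_transfer_op)
  have "(AE x in circle_measure. \<rho> x - transfer_op \<rho> x = transfer_op h x) \<longleftrightarrow>
        (\<forall>n. fourier_coeff (\<lambda>x. \<rho> x - transfer_op \<rho> x) n = fourier_coeff (transfer_op h) n)"
    using fourier_coeff_cong_AE[of "\<lambda>x. \<rho> x - transfer_op \<rho> x" "transfer_op h"]
      fourier_coeff_inject_AE[OF l integrable_transfer_op[OF h]]
      borel_measurable_integrable[OF l] borel_measurable_integrable[OF integrable_transfer_op[OF h]]
    by blast
  then show ?thesis
    unfolding solutions_def lc Lh using True
    by (simp add: fourier_coeff_0 h_def[abs_def] g_def)
qed (simp add: solutions_def)

section \<open>Comparing norms through coefficients\<close>

lemma norm2_mono_fourier_coeff: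
  assumes "f \<in> L2_circle" "g \<in> L2_circle" "\<And>n. cmod (fourier_coeff g n) \<le> cmod (fourier_coeff f n)"
  shows "norm2 g \<le> norm2 f"
proof (rule power2_le_imp_le)
  show "(norm2 g)\<^sup>2 \<le> (norm2 f)\<^sup>2"
    unfolding Parseval[OF assms(1)] Parseval[OF assms(2)]
    by (intro infsum_mono Bessel assms power_mono) auto
qed (simp add: norm2_def)

text \<open>By Parseval the differences of the squared moduli are nonnegative with sum zero, so each
  of them vanishes.\<close>

lemma norm2_eq_imp_norm_fourier_coeff_eq:
  assumes f: "f \<in> L2_circle" and g: "g \<in> L2_circle"
    and le: "\<And>n. cmod (fourier_coeff g n) \<le> cmod (fourier_coeff f n)"
    and eq: "norm2 f = norm2 g"
  shows "cmod (fourier_coeff f n) = cmod (fourier_coeff g n)"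
proof -
  let ?d = "\<lambda>n. (cmod (fourier_coeff f n))\<^sup>2 + - (cmod (fourier_coeff g n))\<^sup>2"
  have s: "(\<lambda>n. - (cmod (fourier_coeff g n))\<^sup>2) summable_on UNIV"
    using Bessel(1)[OF g] by (simp only: summable_on_uminus)
  have "infsum ?d UNIV = (norm2 f)\<^sup>2 - (norm2 g)\<^sup>2"
    unfolding Parseval[OF f] Parseval[OF g] infsum_add[OF Bessel(1)[OF f] s] infsum_uminus by simp
  then have "infsum ?d UNIV \<le> 0"
    by (simp add: eq)
  moreover have "?d summable_on UNIV"
    by (intro summable_on_add Bessel f s)
  ultimately have "?d n = 0"
    by (rule nonneg_infsum_le_0D) (auto intro!: power_mono le)
  then show ?thesis
    by simp
qed

text \<open>The even and odd series merged into one coefficient sequence. At n = 0 division by zero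
  yields 0, which is the condition of zero mean.\<close>

definition solution_coeff :: "(int \<Rightarrow> complex) \<Rightarrow> (int \<Rightarrow> complex) \<Rightarrow> int \<Rightarrow> complex" where
  "solution_coeff a c n = (if even n then - ((a (n div 2) - a n) / (pi * \<i> * of_int n))
                           else c n / (pi * \<i> * of_int n))"

lemma hermitian_solution_coeff:
  assumes "hermitian_seq a" "c \<in> free_coeffs"
  shows "hermitian_seq (solution_coeff a c)"
  unfolding hermitian_seq_def
proof
  fix n
  show "solution_coeff a c (- n) = cnj (solution_coeff a c n)"
  proof (cases "even n")
    case True
    then have "(- n) div 2 = - (n div 2)"
      by (auto elim!: evenE)
    then show ?thesis
      using assms True by (simp add: solution_coeff_def hermitian_seq_def)
  next
    case False
    then show ?thesis
      using assms(2) by (simp add: solution_coeff_def free_coeffs_def)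
  qed
qed

lemma bij_betw_double_evens: "bij_betw (\<lambda>m::int. 2 * m) UNIV {n. even n}"
  by (rule bij_betwI[of _ _ _ "\<lambda>n. n div 2"]) auto

text \<open>The common shape of the derivatives of a solution: first order has p = -2, q = r = 2
  with the coefficients of \<rho>, fourth order of the optimal solution has p = -16, q = 2 with
  those of the third derivative of \<rho>.\<close>

lemma square_summable_even_odd:
  fixes u v c :: "int \<Rightarrow> complex"
  assumes "(\<lambda>n. (cmod (u n))\<^sup>2) summable_on UNIV" "(\<lambda>n. (cmod (v n))\<^sup>2) summable_on UNIV"
    "(\<lambda>n. (cmod (c n))\<^sup>2) summable_on {n. odd n}"
  shows "(\<lambda>n. (cmod (if even n then p * u (n div 2) + q * v n else r * c n))\<^sup>2) summable_on UNIV"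
    (is "?F summable_on UNIV")
proof -
  have "?F summable_on {n. even n}"
  proof (rule summable_on_le)
    have "(\<lambda>n. (cmod (u (n div 2)))\<^sup>2) summable_on {n. even n}"
      using assms(1) by (subst summable_on_reindex_bij_betw[OF bij_betw_double_evens, symmetric]) simp
    moreover have "(\<lambda>n. (cmod (v n))\<^sup>2) summable_on {n. even n}"
      using assms(2) by (rule summable_on_subset_banach) simp
    ultimately show "(\<lambda>n. 2 * (cmod p)\<^sup>2 * (cmod (u (n div 2)))\<^sup>2 + 2 * (cmod q)\<^sup>2 * (cmod (v n))\<^sup>2)
        summable_on {n. even n}"
      by (intro summable_on_add summable_on_cmult_right)
    fix n :: int assume "n \<in> {n. even n}"
    define s where "s = cmod (p * u (n div 2))"
    define t where "t = cmod (q * v n)"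
    have "(cmod (p * u (n div 2) + q * v n))\<^sup>2 \<le> (s + t)\<^sup>2"
      unfolding s_def t_def by (intro power_mono norm_triangle_ineq) auto
    also have "\<dots> \<le> 2 * s\<^sup>2 + 2 * t\<^sup>2"
      using zero_le_power2[of "s - t"] by (simp add: power2_eq_square algebra_simps)
    finally show "?F n \<le> 2 * (cmod p)\<^sup>2 * (cmod (u (n div 2)))\<^sup>2 + 2 * (cmod q)\<^sup>2 * (cmod (v n))\<^sup>2"
      using \<open>n \<in> _\<close> by (simp add: s_def t_def norm_mult power_mult_distrib)
  qed simp
  moreover have "?F summable_on {n. odd n}"
  proof -
    have "(\<lambda>n. (cmod r)\<^sup>2 * (cmod (c n))\<^sup>2) summable_on {n. odd n}"
      by (intro summable_on_cmult_right assms)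
    then show ?thesis
      by (rule summable_on_cong[THEN iffD1, rotated]) (simp add: norm_mult power_mult_distrib)
  qed
  ultimately have "?F summable_on ({n. even n} \<union> {n. odd n})"
    by (rule summable_on_Un_disjoint) auto
  moreover have "{n::int. even n} \<union> {n. odd n} = UNIV"
    by auto
  ultimately show ?thesis
    by (simp only:)
qed

section \<open>The solution set as a family of series\<close>

context
  fixes \<rho> :: "real \<Rightarrow> real" and a :: "int \<Rightarrow> complex"
  assumes \<rho>: "\<rho> \<in> Ck_circle 1" and a: "a = fourier_coeff \<rho>"
begin

lemma \<rho>_L2: "\<rho> \<in> L2_circle"
  using Ck_circle_1D[OF \<rho>] by (intro continuous_imp_L2_circle)

lemma hermitian_a: "hermitian_seq a"
  unfolding a by (rule hermitian_fourier_coeff)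

text \<open>The derivative factor cancels the denominators. At n = 0 the right side is consistent
  because 0 div 2 = 0 makes its two terms cancel.\<close>

lemma deriv_solution_coeff:
  "2 * pi * \<i> * of_int n * solution_coeff a c n =
     (if even n then (- 2) * a (n div 2) + 2 * a n else 2 * c n)"
proof (cases "n = 0")
  case False
  define w where "w = pi * \<i> * of_int n"
  have w: "w \<noteq> 0"
    using False by (simp add: w_def)
  have w2: "2 * pi * \<i> * of_int n = 2 * w"
    by (simp add: w_def)
  show ?thesis
    unfolding w2 solution_coeff_def w_def[symmetric] using w by (simp add: field_simps)
qed (simp add: solution_coeff_def)

lemma square_summable_deriv_solution_coeff:
  assumes "c \<in> free_coeffs"
  shows "(\<lambda>n. (cmod (2 * pi * \<i> * of_int n * solution_coeff a c n))\<^sup>2) summable_on UNIV"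
  unfolding deriv_solution_coeff
  using assms Bessel(1)[OF \<rho>_L2] by (intro square_summable_even_odd) (auto simp: a free_coeffs_def)

lemma summable_solution_coeff:
  assumes "c \<in> free_coeffs"
  shows "(\<lambda>n. cmod (solution_coeff a c n)) summable_on UNIV"
  by (intro summable_norm_if_deriv_square_summable square_summable_deriv_solution_coeff assms)

text \<open>Both series are subseries of one absolutely convergent series, whose coefficient at 0
  vanishes.\<close>

lemma solution_series_facts:
  assumes c: "c \<in> free_coeffs"
  shows "even_term a x summable_on ({n. even n} - {0})"
    and "odd_term c x summable_on {n. odd n}"
    and "solution_series a c x = fourier_series (solution_coeff a c) x"
proof -
  let ?f = "\<lambda>n. solution_coeff a c n * fourier_char n x"
  have s: "?f summable_on A" for A
    by (intro summable_fourier_series summable_solution_coeff c)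
  have even: "?f n = - even_term a x n" if "n \<in> {n. even n} - {0}" for n
    using that by (simp add: solution_coeff_def even_term_def)
  have odd: "?f n = odd_term c x n" if "n \<in> {n. odd n}" for n
    using that by (simp add: solution_coeff_def odd_term_def)
  have "(\<lambda>n. - even_term a x n) summable_on ({n. even n} - {0})"
    by (rule summable_on_cong[THEN iffD1, OF even s])
  then show "even_term a x summable_on ({n. even n} - {0})"
    by (simp add: summable_on_uminus)
  show "odd_term c x summable_on {n. odd n}"
    by (rule summable_on_cong[THEN iffD1, OF odd s])
  have "fourier_series (solution_coeff a c) x = infsum ?f (({n. even n} - {0}) \<union> {n. odd n})"
    unfolding fourier_series_def by (rule infsum_cong_neutral) (auto simp: solution_coeff_def)
  also have "\<dots> = infsum ?f ({n. even n} - {0}) + infsum ?f {n. odd n}"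
    by (intro infsum_Un_disjoint s) auto
  also have "infsum ?f ({n. even n} - {0}) = infsum (\<lambda>n. - even_term a x n) ({n. even n} - {0})"
    by (rule infsum_cong[OF even])
  also have "\<dots> = - infsum (even_term a x) ({n. even n} - {0})"
    by (rule infsum_uminus)
  also have "infsum ?f {n. odd n} = infsum (odd_term c x) {n. odd n}"
    by (rule infsum_cong[OF odd])
  finally show "solution_series a c x = fourier_series (solution_coeff a c) x"
    by (simp add: solution_series_def)
qed

lemma solution_series_real:
  assumes "c \<in> free_coeffs"
  shows "solution_series a c x \<in> \<real>"
  unfolding solution_series_facts(3)[OF assms]
  by (intro fourier_series_real hermitian_solution_coeff hermitian_a assms)

text \<open>A solution has exactly the coefficients \<open>solution_coeff a c\<close> for a suitable
  \<open>c\<close>, so it equals its series almost everywhere. Conversely, a function equal to the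
  series almost everywhere inherits measurability, square integrability and coefficients from the
  continuous sum \<open>s\<close>, and the coefficient criterion for solutions applies.\<close>

lemma solutions_iff_series:
  assumes circle: "circle_fun \<epsilon>"
  shows "\<epsilon> \<in> solutions \<rho> \<longleftrightarrow>
    (\<exists>c \<in> free_coeffs. AE x in circle_measure. complex_of_real (\<epsilon> x) = solution_series a c x)"
proof
  assume "\<epsilon> \<in> solutions \<rho>"
  then have \<epsilon>: "\<epsilon> \<in> Hk_circle 1" "fourier_coeff \<epsilon> 0 = 0"
    "\<And>n. a n - a (2 * n) = - 2 * pi * \<i> * of_int n * fourier_coeff \<epsilon> (2 * n)"
    using solutions_iff[OF L2_circle_imp_integrable[OF \<rho>_L2]] by (simp_all add: a)
  \<comment> \<open>Obtained by solving the odd case of \<open>solution_coeff\<close> for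
    \<open>c n\<close>; it is half the coefficient of the weak derivative, hence the factor 1/4 in
    the squares.\<close>
  define c where "c n = pi * \<i> * of_int n * fourier_coeff \<epsilon> n" for n
  define g where "g = weak_deriv 1 \<epsilon>"
  have g: "g \<in> L2_circle"
      "\<And>n. fourier_coeff g n = 2 * pi * \<i> * of_int n * fourier_coeff \<epsilon> n"
    using weak_deriv_Hk_circle[OF \<epsilon>(1) order_refl] by (simp_all add: g_def)
  have c: "c \<in> free_coeffs"
    unfolding free_coeffs_def
  proof (intro CollectI conjI allI impI)
    have "(\<lambda>n. (cmod (fourier_coeff g n))\<^sup>2 * (1 / 4)) summable_on {n. odd n}"
      by (intro summable_on_cmult_left summable_on_subset_banach[OF Bessel(1)[OF g(1)]]) simp
    moreover have "(cmod (fourier_coeff g n))\<^sup>2 * (1 / 4) = (cmod (c n))\<^sup>2" for n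
      by (simp add: g(2) c_def norm_mult power_mult_distrib)
    ultimately show "(\<lambda>n. (cmod (c n))\<^sup>2) summable_on {n. odd n}"
      by simp
  qed (simp add: c_def fourier_coeff_minus)
  have coeff: "fourier_coeff \<epsilon> n = solution_coeff a c n" for n
  proof (cases "even n")
    case True
    then obtain m where m: "n = 2 * m"
      by (auto elim: evenE)
    show ?thesis
      using \<epsilon>(2) \<epsilon>(3)[of m] by (cases "m = 0") (auto simp: m solution_coeff_def field_simps)
  next
    case False
    then have "n \<noteq> 0"
      by auto
    then show ?thesis
      using False by (simp add: solution_coeff_def c_def)
  qed
  have "AE x in circle_measure. complex_of_real (\<epsilon> x) = fourier_series (fourier_coeff \<epsilon>) x"
    using \<epsilon>(1) summable_solution_coeff[OF c]
    by (intro AE_eq_fourier_series L2_circle_imp_integrable) (simp_all add: Hk_circle_def coeff)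
  moreover have "fourier_coeff \<epsilon> = solution_coeff a c"
    by (rule ext) (rule coeff)
  ultimately show "\<exists>c \<in> free_coeffs. AE x in circle_measure. complex_of_real (\<epsilon> x) = solution_series a c x"
    using c solution_series_facts(3)[OF c] by (intro bexI[of _ c]) simp_all
next
  assume "\<exists>c \<in> free_coeffs. AE x in circle_measure. complex_of_real (\<epsilon> x) = solution_series a c x"
  then obtain c where c: "c \<in> free_coeffs"
    and ae: "AE x in circle_measure. complex_of_real (\<epsilon> x) = fourier_series (solution_coeff a c) x"
    using solution_series_facts(3) by auto
  define s where "s x = Re (fourier_series (solution_coeff a c) x)" for x
  have s_cont: "continuous_on UNIV s"
    unfolding s_def by (intro continuous_intros continuous_on_fourier_series summable_solution_coeff c)
  have ae': "AE x in circle_measure. s x = \<epsilon> x"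
    using ae by eventually_elim (metis s_def Re_complex_of_real)
  have [measurable]: "s \<in> borel_measurable circle_measure"
    by (rule measurable_circle_continuous[OF s_cont])
  have \<epsilon>_meas [measurable]: "\<epsilon> \<in> borel_measurable circle_measure"
    by (rule borel_measurable_circle_AE[OF _ ae']) measurable
  have \<epsilon>_L2: "\<epsilon> \<in> L2_circle"
    unfolding L2_circle_def
  proof (intro CollectI conjI circle \<epsilon>_meas)
    have "integrable circle_measure (\<lambda>x. (s x)\<^sup>2)"
      by (intro integrable_circle_continuous continuous_intros s_cont)
    then show "integrable circle_measure (\<lambda>x. (\<epsilon> x)\<^sup>2)"
      by (rule integrable_cong_AE_imp) (use ae' in \<open>auto elim!: eventually_mono\<close>)
  qed
  have coeff: "fourier_coeff \<epsilon> n = solution_coeff a c n" for n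
  proof -
    have "fourier_coeff s n = fourier_coeff \<epsilon> n"
      by (rule fourier_coeff_cong_AE[OF ae']) measurable
    then show ?thesis
      unfolding s_def
      by (simp add: fourier_coeff_fourier_series summable_solution_coeff c hermitian_solution_coeff hermitian_a)
  qed
  have "\<epsilon> \<in> Hk_circle 1"
    using square_summable_deriv_solution_coeff[OF c]
    by (intro Hk_circle_if_square_summable \<epsilon>_L2) (simp add: coeff)
  moreover have "fourier_coeff \<epsilon> 0 = 0"
    by (simp add: coeff solution_coeff_def)
  moreover have "a n - a (2 * n) = - 2 * pi * \<i> * of_int n * fourier_coeff \<epsilon> (2 * n)" for n
    by (cases "n = 0") (auto simp: coeff solution_coeff_def field_simps)
  ultimately show "\<epsilon> \<in> solutions \<rho>"
    using solutions_iff[OF L2_circle_imp_integrable[OF \<rho>_L2]] by (simp add: a)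
qed

lemma zero_in_free_coeffs: "(\<lambda>_. 0) \<in> free_coeffs"
  by (simp add: free_coeffs_def)

lemma optimal_series_facts:
  shows "optimal_term a x summable_on (UNIV - {0})"
    and "optimal_series a x = solution_series a (\<lambda>_. 0) x"
proof -
  have reindex: "optimal_term a x n = even_term a x (2 * n)" for n
    by (simp add: optimal_term_def even_term_def mult_ac)
  have bij: "bij_betw (\<lambda>m::int. 2 * m) (UNIV - {0}) ({n. even n} - {0})"
    by (rule bij_betwI[of _ _ _ "\<lambda>n. n div 2"]) auto
  show "optimal_term a x summable_on (UNIV - {0})"
    unfolding reindex[abs_def] summable_on_reindex_bij_betw[OF bij]
    by (rule solution_series_facts(1)[OF zero_in_free_coeffs])
  show "optimal_series a x = solution_series a (\<lambda>_. 0) x"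
    unfolding optimal_series_def solution_series_def reindex[abs_def] infsum_reindex_bij_betw[OF bij]
    by (simp add: odd_term_def[abs_def])
qed

section \<open>Minimality of the optimal solution\<close>

lemma solution_even_fourier_coeff:
  assumes "f \<in> solutions \<rho>" "even n"
  shows "fourier_coeff f n = solution_coeff a c n"
proof -
  obtain m where m: "n = 2 * m"
    using assms(2) by (auto elim: evenE)
  have "fourier_coeff f 0 = 0" "a m - a (2 * m) = - 2 * pi * \<i> * of_int m * fourier_coeff f (2 * m)"
    using assms(1) solutions_iff[OF L2_circle_imp_integrable[OF \<rho>_L2]] by (simp_all add: a)
  then show ?thesis
    by (cases "m = 0") (auto simp: m solution_coeff_def field_simps)
qed

definition optimal :: "real \<Rightarrow> real" where
  "optimal x = Re (optimal_series a x)"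

lemma optimal_eq: "optimal x = Re (fourier_series (solution_coeff a (\<lambda>_. 0)) x)"
  by (simp add: optimal_def optimal_series_facts solution_series_facts(3)[OF zero_in_free_coeffs])

lemma of_real_optimal: "complex_of_real (optimal x) = solution_series a (\<lambda>_. 0) x"
  using solution_series_real[OF zero_in_free_coeffs, of x] by (simp add: optimal_def optimal_series_facts)

lemma fourier_coeff_optimal: "fourier_coeff optimal n = solution_coeff a (\<lambda>_. 0) n"
  unfolding optimal_eq[abs_def]
  by (intro fourier_coeff_fourier_series summable_solution_coeff hermitian_solution_coeff
        hermitian_a zero_in_free_coeffs)

lemma optimal_in_solutions: "optimal \<in> solutions \<rho>"
proof -
  have "circle_fun optimal"
    by (simp add: circle_fun_def optimal_eq fourier_series_periodic)
  then show ?thesis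
    using zero_in_free_coeffs by (subst solutions_iff_series) (auto simp: of_real_optimal intro!: bexI)
qed

lemma solutions_L2_circle: "f \<in> solutions \<rho> \<Longrightarrow> f \<in> L2_circle"
  by (simp add: solutions_def Hk_circle_def)

text \<open>At even n the coefficients coincide, at odd n the optimal one is 0. This inequality at
  each frequency survives multiplication by (2 pi i n)^j, so it yields minimality for the weak
  derivatives too.\<close>

lemma norm_fourier_coeff_optimal_le:
  assumes "f \<in> solutions \<rho>"
  shows "cmod (fourier_coeff optimal n) \<le> cmod (fourier_coeff f n)"
  using solution_even_fourier_coeff[OF assms, of n]
  by (cases "even n") (auto simp: fourier_coeff_optimal solution_coeff_def)

lemma norm2_optimal_le: "f \<in> solutions \<rho> \<Longrightarrow> norm2 optimal \<le> norm2 f"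
  by (intro norm2_mono_fourier_coeff norm_fourier_coeff_optimal_le solutions_L2_circle optimal_in_solutions)

text \<open>Equal norms give only equal moduli of coefficients. That is enough: at odd n the modulus
  is 0, and at even n all solutions share the same coefficient.\<close>

lemma norm2_eq_optimal_imp_AE_eq:
  assumes f: "f \<in> solutions \<rho>" and eq: "norm2 f = norm2 optimal"
  shows "AE x in circle_measure. f x = optimal x"
proof -
  have "fourier_coeff f n = fourier_coeff optimal n" for n
  proof (cases "even n")
    case True
    then show ?thesis
      using solution_even_fourier_coeff[OF f] by (simp add: fourier_coeff_optimal)
  next
    case False
    have "cmod (fourier_coeff f n) = cmod (fourier_coeff optimal n)"
      by (intro norm2_eq_imp_norm_fourier_coeff_eq norm_fourier_coeff_optimal_le solutions_L2_circle
            optimal_in_solutions f eq)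
    then show ?thesis
      using False by (simp add: fourier_coeff_optimal solution_coeff_def)
  qed
  then show ?thesis
    by (intro fourier_coeff_inject_AE L2_circle_imp_integrable solutions_L2_circle f optimal_in_solutions)
qed

lemma unique_minimiser_norm2_optimal: "unique_minimiser norm2 (solutions \<rho>) optimal"
  by (simp add: unique_minimiser_def optimal_in_solutions norm2_optimal_le norm2_eq_optimal_imp_AE_eq)

text \<open>At the even frequency \<open>n\<close> the fourth derivative of the optimal solution has the coefficient
  \<open>(2 \<pi> i n)\<^sup>3 \<cdot> 2 (a\<^sub>n - a\<^bsub>n/2\<^esub>)\<close>, a combination of the coefficients of \<open>\<rho>'''\<close> at \<open>n\<close> and \<open>n/2\<close>.\<close>

lemma optimal_in_Hk_circle_4:
  assumes \<rho>3: "\<rho> \<in> Ck_circle 3"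
  shows "optimal \<in> Hk_circle 4"
proof (rule Hk_circle_if_square_summable[OF solutions_L2_circle[OF optimal_in_solutions]])
  define v where "v = fourier_coeff ((deriv ^^ 3) \<rho>)"
  have v: "v n = (2 * pi * \<i> * of_int n) ^ 3 * a n" for n
    unfolding v_def a by (rule fourier_coeff_funpow_deriv[OF \<rho>3])
  have "(deriv ^^ 3) \<rho> \<in> Ck_circle 0"
    using \<rho>3 by (intro funpow_deriv_in_Ck_circle) simp
  then have v_summable: "(\<lambda>n. (cmod (v n))\<^sup>2) summable_on UNIV"
    unfolding v_def by (intro Bessel Ck_circle_0_imp_L2_circle)
  \<comment> \<open>With n = 2m the cube of 2 pi i n is 8 times that of 2 pi i m, so the factor -2
    at \<open>n div 2\<close> becomes -16.\<close>
  have eq: "(2 * pi * \<i> * of_int n) ^ 4 * fourier_coeff optimal n =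
    (if even n then (- 16) * v (n div 2) + 2 * v n else 2 * 0)" for n
  proof -
    have "(2 * pi * \<i> * of_int n) ^ 4 * fourier_coeff optimal n =
        (2 * pi * \<i> * of_int n) ^ 3 * (2 * pi * \<i> * of_int n * solution_coeff a (\<lambda>_. 0) n)"
      by (simp add: fourier_coeff_optimal eval_nat_numeral)
    also have "\<dots> = (if even n then (2 * pi * \<i> * of_int n) ^ 3 * ((- 2) * a (n div 2) + 2 * a n) else 2 * 0)"
      unfolding deriv_solution_coeff by simp
    also have "\<dots> = (if even n then (- 16) * v (n div 2) + 2 * v n else 2 * 0)"
    proof (cases "even n")
      case True
      then obtain m where "n = 2 * m"
        by (auto elim: evenE)
      then show ?thesis
        by (simp add: v power_mult_distrib algebra_simps)
    qed simp
    finally show ?thesis .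
  qed
  show "(\<lambda>n. (cmod ((2 * pi * \<i> * of_int n) ^ 4 * fourier_coeff optimal n))\<^sup>2) summable_on UNIV"
    unfolding eq by (intro square_summable_even_odd v_summable) simp
qed

lemma norm2_weak_deriv_optimal_le:
  assumes "optimal \<in> Hk_circle k" "f \<in> solutions \<rho>" "f \<in> Hk_circle k" "j \<le> k"
  shows "norm2 (weak_deriv j optimal) \<le> norm2 (weak_deriv j f)"
proof (rule norm2_mono_fourier_coeff)
  show "weak_deriv j f \<in> L2_circle" "weak_deriv j optimal \<in> L2_circle"
    using assms by (auto intro: weak_deriv_Hk_circle)
  show "cmod (fourier_coeff (weak_deriv j optimal) n) \<le> cmod (fourier_coeff (weak_deriv j f) n)" for n
    unfolding weak_deriv_Hk_circle(2)[OF assms(1,4)] weak_deriv_Hk_circle(2)[OF assms(3,4)] norm_mult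
    by (intro mult_left_mono norm_fourier_coeff_optimal_le assms) auto
qed

text \<open>\<open>optimal\<close> minimises every summand separately, so equality of the sums
  forces equality of the summand \<open>norm2\<close>, for which uniqueness is already
  known.\<close>

lemma unique_minimiser_weighted_optimal:
  assumes \<rho>3: "\<rho> \<in> Ck_circle 3" and nonneg: "\<alpha> \<ge> 0" "\<beta> \<ge> 0" "\<gamma> \<ge> 0" "\<delta> \<ge> 0"
  shows "unique_minimiser
    (\<lambda>f. norm2 f + \<alpha> * norm2 (weak_deriv 1 f) + \<beta> * norm2 (weak_deriv 2 f)
         + \<gamma> * norm2 (weak_deriv 3 f) + \<delta> * norm2 (weak_deriv 4 f))
    (solutions \<rho> \<inter> Hk_circle 4) optimal"
    (is "unique_minimiser (\<lambda>f. norm2 f + ?A f + ?B f + ?C f + ?D f) _ _")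
proof -
  note H4 = optimal_in_Hk_circle_4[OF \<rho>3]
  have le: "?A optimal \<le> ?A f" "?B optimal \<le> ?B f" "?C optimal \<le> ?C f" "?D optimal \<le> ?D f"
      "norm2 optimal \<le> norm2 f"
    if "f \<in> solutions \<rho> \<inter> Hk_circle 4" for f
    using that nonneg
    by (auto intro!: mult_left_mono norm2_weak_deriv_optimal_le[OF H4] norm2_optimal_le)
  show ?thesis
    unfolding unique_minimiser_def
  proof (intro conjI ballI impI)
    show "optimal \<in> solutions \<rho> \<inter> Hk_circle 4"
      using H4 optimal_in_solutions by simp
  next
    fix f assume "f \<in> solutions \<rho> \<inter> Hk_circle 4"
    from le[OF this] show "norm2 optimal + ?A optimal + ?B optimal + ?C optimal + ?D optimal
        \<le> norm2 f + ?A f + ?B f + ?C f + ?D f"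
      by linarith
  next
    fix f assume f: "f \<in> solutions \<rho> \<inter> Hk_circle 4"
      and "norm2 f + ?A f + ?B f + ?C f + ?D f =
        norm2 optimal + ?A optimal + ?B optimal + ?C optimal + ?D optimal"
    with le[OF f] have "norm2 f = norm2 optimal"
      by linarith
    with f show "AE x in circle_measure. f x = optimal x"
      by (intro norm2_eq_optimal_imp_AE_eq) auto
  qed
qed

end

theorem mainTheorem3:
  fixes \<rho> :: "real \<Rightarrow> real" and a :: "int \<Rightarrow> complex" and \<epsilon>\<^sub>0 :: "real \<Rightarrow> real"
  assumes \<rho>: "\<rho> \<in> Ck_circle 1"
    and a: "a = fourier_coeff \<rho>"
    and \<epsilon>\<^sub>0: "\<epsilon>\<^sub>0 = (\<lambda>x. Re (optimal_series a x))"
  shows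
    "((\<forall>c \<in> free_coeffs. \<forall>x.
         even_term a x summable_on ({n. even n} - {0}) \<and>
         odd_term c x summable_on {n. odd n} \<and>
         solution_series a c x \<in> \<real>) \<and>
      (\<forall>\<epsilon>. circle_fun \<epsilon> \<longrightarrow>
         (\<epsilon> \<in> solutions \<rho> \<longleftrightarrow>
            (\<exists>c \<in> free_coeffs. AE x in circle_measure.
               complex_of_real (\<epsilon> x) = solution_series a c x))))
     \<and>
     ((\<forall>x. optimal_term a x summable_on (UNIV - {0}) \<and>
           complex_of_real (\<epsilon>\<^sub>0 x) = optimal_series a x \<and>
           optimal_series a x = solution_series a (\<lambda>_. 0) x) \<and>
      unique_minimiser norm2 (solutions \<rho>) \<epsilon>\<^sub>0)
     \<and>
     (\<rho> \<in> Ck_circle 3 \<longrightarrow>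
        (\<forall>\<alpha>\<ge>0. \<forall>\<beta>\<ge>0. \<forall>\<gamma>\<ge>0. \<forall>\<delta>>0.
           unique_minimiser
             (\<lambda>f. norm2 f + \<alpha> * norm2 (weak_deriv 1 f) + \<beta> * norm2 (weak_deriv 2 f)
                  + \<gamma> * norm2 (weak_deriv 3 f) + \<delta> * norm2 (weak_deriv 4 f))
             (solutions \<rho> \<inter> Hk_circle 4) \<epsilon>\<^sub>0))"
proof -
  have opt: "\<epsilon>\<^sub>0 = optimal a"
    by (rule ext) (simp add: \<epsilon>\<^sub>0 optimal_def[OF \<rho> a])
  show ?thesis
    unfolding opt
    using solution_series_facts[OF \<rho> a] solution_series_real[OF \<rho> a] solutions_iff_series[OF \<rho> a]
      optimal_series_facts[OF \<rho> a] of_real_optimal[OF \<rho> a]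
      unique_minimiser_norm2_optimal[OF \<rho> a] unique_minimiser_weighted_optimal[OF \<rho> a]
    by auto
qed

end
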